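(* There exists an absolute constant $C>0$ such that for the Thue-Morse sequence $v=\{v(n)\}_{n\in\mathbb{Z}}$ and every $\lambda\in\mathbb{R}$, the spectrum $\sigma(H_{\lambda,v})$ of the Thue-Morse Hamiltonian $H_{\lambda,v}$ satisfies $$\dim_H\sigma(H_{\lambda,v})\ge C,$$ where $\dim_H$ denotes Hausdorff dimension.
   Context: Thue-Morse substitution on the alphabet $\{a,b\}$: $\sigma(a)=ab$, $\sigma(b)=ba$. Let $u=u_1u_2u_3\cdots:=\sigma^\infty(a)$ be the infinite fixed word of the substitution starting with $a$ (the limit of the words $\sigma^n(a)$, each of which is a prefix of the next). The two-sided Thue-Morse sequence $v=\{v(n)\}_{n\in\mathbb{Z}}$ is defined by: for $n\ge1$, $v(n)=1$ if $u_n=a$ and $v(n)=-1$ if $u_n=b$; and $v(1-n)=v(n)$ for $n\ge 1$. For $\lambda\in\mathbb{R}$, the Thue-Morse Hamiltonian is the bounded self-adjoint operator $H_{\lambda,v}$ on $\ell^2(\mathbb{Z})$ given by $(H_{\lambda,v}\psi)(n)=\psi(n+1)+\psi(n-1)+\lambda v(n)\psi(n)$ for all $n\in\mathbb{Z}$; $\sigma(H_{\lambda,v})\subset\mathbb{R}$ denotes its spectrum. *)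

theory Defs
  imports "HOL-Analysis.Analysis" "HOL-Library.Sublist"
begin

section \<open>The Thue-Morse sequence\<close>

datatype letter = LA | LB

fun tm_letter :: "letter \<Rightarrow> letter list" where
  "tm_letter LA = [LA, LB]"
| "tm_letter LB = [LB, LA]"

definition tm_subst :: "letter list \<Rightarrow> letter list" where
  "tm_subst w = concat (map tm_letter w)"

definition tm_word :: "nat \<Rightarrow> letter list" where
  "tm_word m = (tm_subst ^^ m) [LA]"

text \<open>
  The infinite word \<open>u = u\<^sub>1 u\<^sub>2 u\<^sub>3 \<dots>\<close> is indexed from 1; \<open>tm_u 0\<close> is irrelevant.
  As the word \<open>tm_word n\<close> has length \<open>2 ^ n > n\<close> and the words are prefixes of each other, any
  sufficiently long word could be used instead; see \<open>tm_word_nth\<close> below.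
\<close>

definition tm_u :: "nat \<Rightarrow> letter" where
  "tm_u n = tm_word n ! (n - 1)"

definition thue_morse :: "int \<Rightarrow> real" where
  "thue_morse n =
     (let k = nat (if n \<ge> 1 then n else 1 - n) in if tm_u k = LA then 1 else - 1)"

lemma length_tm_letter [simp]: "length (tm_letter c) = 2"
  by (cases c) auto

lemma length_tm_subst: "length (tm_subst w) = 2 * length w"
  by (induction w) (auto simp: tm_subst_def)

lemma tm_subst_append: "tm_subst (w @ w') = tm_subst w @ tm_subst w'"
  by (simp add: tm_subst_def)

lemma tm_word_Suc: "tm_word (Suc m) = tm_subst (tm_word m)"
  by (simp add: tm_word_def)

lemma length_tm_word: "length (tm_word m) = 2 ^ m"
  by (induction m) (simp_all add: tm_word_Suc length_tm_subst, simp add: tm_word_def)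

lemma tm_word_prefix_Suc: "prefix (tm_word m) (tm_word (Suc m))"
proof (induction m)
  case 0
  then show ?case by (simp add: tm_word_def tm_subst_def)
next
  case (Suc m)
  then obtain w where "tm_word (Suc m) = tm_word m @ w"
    by (auto simp: prefix_def)
  then have "tm_subst (tm_word (Suc m)) = tm_subst (tm_word m) @ tm_subst w"
    by (simp only: tm_subst_append)
  then show ?case by (simp only: tm_word_Suc prefixI)
qed

lemma tm_word_prefix: "m \<le> k \<Longrightarrow> prefix (tm_word m) (tm_word k)"
  by (induction k rule: dec_induct) (auto intro: prefix_order.trans tm_word_prefix_Suc)

lemma tm_word_nth:
  assumes "1 \<le> n" "n \<le> length (tm_word m)"
  shows "tm_u n = tm_word m ! (n - 1)"
proof -
  have *: "tm_word k ! (n - 1) = tm_word l ! (n - 1)"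
    if "k \<le> l" "n \<le> length (tm_word k)" for k l
    using tm_word_prefix[OF that(1)] that(2) assms(1)
    by (auto simp: prefix_def nth_append)
  have "n \<le> length (tm_word n)"
    by (simp add: length_tm_word)
  then show ?thesis
    unfolding tm_u_def using *[of n m] *[of m n] assms(2) nat_le_linear[of n m] by metis
qed

lemma thue_morse_pos: "n \<ge> 1 \<Longrightarrow> thue_morse (int n) = (if tm_u n = LA then 1 else - 1)"
  by (simp add: thue_morse_def)

lemma thue_morse_reflect: "n \<ge> 1 \<Longrightarrow> thue_morse (1 - n) = thue_morse n"
  by (simp add: thue_morse_def)

lemma abs_thue_morse [simp]: "\<bar>thue_morse n\<bar> = 1"
  by (simp add: thue_morse_def Let_def)


section \<open>The Hilbert space of square-summable functions\<close>

typedef 'a ell2 = "{f :: 'a \<Rightarrow> complex. (\<lambda>i. (cmod (f i))\<^sup>2) summable_on UNIV}"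
  morphisms ell2_fun Abs_ell2
  by (rule exI[of _ "\<lambda>_. 0"]) simp

setup_lifting type_definition_ell2

lemma sq_summable_add:
  fixes f g :: "'a \<Rightarrow> complex"
  assumes "(\<lambda>i. (cmod (f i))\<^sup>2) summable_on UNIV" "(\<lambda>i. (cmod (g i))\<^sup>2) summable_on UNIV"
  shows "(\<lambda>i. (cmod (f i + g i))\<^sup>2) summable_on UNIV"
proof (rule summable_on_comparison_test)
  show "(\<lambda>i. 2 * (cmod (f i))\<^sup>2 + 2 * (cmod (g i))\<^sup>2) summable_on UNIV"
    by (intro summable_on_add summable_on_cmult_right assms)
  show "(cmod (f i + g i))\<^sup>2 \<le> 2 * (cmod (f i))\<^sup>2 + 2 * (cmod (g i))\<^sup>2" for i
  proof -
    have "(cmod (f i + g i))\<^sup>2 \<le> (cmod (f i) + cmod (g i))\<^sup>2"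
      by (intro power_mono norm_triangle_ineq) auto
    also have "\<dots> \<le> 2 * (cmod (f i))\<^sup>2 + 2 * (cmod (g i))\<^sup>2"
      using zero_le_power2[of "cmod (f i) - cmod (g i)"] by (simp add: power2_eq_square algebra_simps)
    finally show ?thesis .
  qed
qed simp

lemma sq_summable_bounded_mult:
  fixes f g :: "'a \<Rightarrow> complex"
  assumes "(\<lambda>i. (cmod (f i))\<^sup>2) summable_on UNIV" and bd: "\<And>i. cmod (g i) \<le> K"
  shows "(\<lambda>i. (cmod (g i * f i))\<^sup>2) summable_on UNIV"
proof (rule summable_on_comparison_test)
  show "(\<lambda>i. K\<^sup>2 * (cmod (f i))\<^sup>2) summable_on UNIV"
    by (intro summable_on_cmult_right assms)
  show "(cmod (g i * f i))\<^sup>2 \<le> K\<^sup>2 * (cmod (f i))\<^sup>2" for i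
    by (auto simp: norm_mult power_mult_distrib intro!: mult_right_mono power_mono bd)
qed simp

lemma sq_summable_cmult:
  fixes f :: "'a \<Rightarrow> complex"
  assumes "(\<lambda>i. (cmod (f i))\<^sup>2) summable_on UNIV"
  shows "(\<lambda>i. (cmod (c * f i))\<^sup>2) summable_on UNIV"
  by (rule sq_summable_bounded_mult[OF assms order.refl])

lemma sq_summable_inner:
  fixes f g :: "'a \<Rightarrow> complex"
  assumes "(\<lambda>i. (cmod (f i))\<^sup>2) summable_on UNIV" "(\<lambda>i. (cmod (g i))\<^sup>2) summable_on UNIV"
  shows "(\<lambda>i. cnj (f i) * g i) summable_on UNIV"
proof -
  have "(\<lambda>i. norm (cnj (f i) * g i)) summable_on UNIV"
  proof (rule summable_on_comparison_test)
    show "(\<lambda>i. (cmod (f i))\<^sup>2 + (cmod (g i))\<^sup>2) summable_on UNIV"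
      by (intro summable_on_add assms)
    show "cmod (cnj (f i) * g i) \<le> (cmod (f i))\<^sup>2 + (cmod (g i))\<^sup>2" for i
    proof -
      have "2 * (cmod (f i) * cmod (g i)) \<le> (cmod (f i))\<^sup>2 + (cmod (g i))\<^sup>2"
        using sum_squares_bound[of "cmod (f i)" "cmod (g i)"] by (simp add: mult.assoc)
      moreover have "0 \<le> cmod (f i) * cmod (g i)" by simp
      ultimately have "cmod (f i) * cmod (g i) \<le> (cmod (f i))\<^sup>2 + (cmod (g i))\<^sup>2" by linarith
      then show ?thesis by (simp add: norm_mult)
    qed
  qed simp
  then show ?thesis by (rule abs_summable_summable)
qed

text \<open>Linear in the second argument, antilinear in the first.\<close>

definition cinner_ell2 :: "'a ell2 \<Rightarrow> 'a ell2 \<Rightarrow> complex" where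
  "cinner_ell2 x y = (\<Sum>\<^sub>\<infinity>i. cnj (ell2_fun x i) * ell2_fun y i)"

lift_definition scaleC_ell2 :: "complex \<Rightarrow> 'a ell2 \<Rightarrow> 'a ell2" is "\<lambda>c f i. c * f i"
  by (rule sq_summable_cmult)

text \<open>
  The type classes only know real scalars, so the real inner product is the real part of
  \<^const>\<open>cinner_ell2\<close>.
\<close>

instantiation ell2 :: (type) real_inner
begin

lift_definition zero_ell2 :: "'a ell2" is "\<lambda>_. 0" by simp
lift_definition plus_ell2 :: "'a ell2 \<Rightarrow> 'a ell2 \<Rightarrow> 'a ell2" is "\<lambda>f g i. f i + g i"
  by (rule sq_summable_add)
lift_definition uminus_ell2 :: "'a ell2 \<Rightarrow> 'a ell2" is "\<lambda>f i. - f i" by simp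
lift_definition minus_ell2 :: "'a ell2 \<Rightarrow> 'a ell2 \<Rightarrow> 'a ell2" is "\<lambda>f g i. f i - g i"
proof -
  fix f g :: "'a \<Rightarrow> complex"
  assume "(\<lambda>i. (cmod (f i))\<^sup>2) summable_on UNIV" "(\<lambda>i. (cmod (g i))\<^sup>2) summable_on UNIV"
  then show "(\<lambda>i. (cmod (f i - g i))\<^sup>2) summable_on UNIV"
    using sq_summable_add[of f "\<lambda>i. - g i"] by simp
qed
definition scaleR_ell2 :: "real \<Rightarrow> 'a ell2 \<Rightarrow> 'a ell2" where
  "scaleR_ell2 r = scaleC_ell2 (complex_of_real r)"
definition inner_ell2 :: "'a ell2 \<Rightarrow> 'a ell2 \<Rightarrow> real" where
  "inner_ell2 x y = Re (cinner_ell2 x y)"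
definition norm_ell2 :: "'a ell2 \<Rightarrow> real" where
  "norm_ell2 x = sqrt (\<Sum>\<^sub>\<infinity>i. (cmod (ell2_fun x i))\<^sup>2)"
definition dist_ell2 :: "'a ell2 \<Rightarrow> 'a ell2 \<Rightarrow> real" where
  "dist_ell2 x y = norm (x - y)"
definition sgn_ell2 :: "'a ell2 \<Rightarrow> 'a ell2" where
  "sgn_ell2 x = scaleR (inverse (norm x)) x"
definition uniformity_ell2 :: "('a ell2 \<times> 'a ell2) filter" where
  "uniformity_ell2 = (INF e\<in>{0 <..}. principal {(x, y). dist x y < e})"
definition open_ell2 :: "'a ell2 set \<Rightarrow> bool" where
  "open_ell2 U = (\<forall>x\<in>U. eventually (\<lambda>(x', y). x' = x \<longrightarrow> y \<in> U) uniformity)"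

lemma ell2_summable: "(\<lambda>i. (cmod (ell2_fun x i))\<^sup>2) summable_on UNIV"
  using ell2_fun[of x] by simp

lemma cinner_ell2_summable: "(\<lambda>i. cnj (ell2_fun x i) * ell2_fun y i) summable_on UNIV"
  by (rule sq_summable_inner) (rule ell2_summable)+

lemma cinner_ell2_add_left: "cinner_ell2 (x + y) z = cinner_ell2 x z + cinner_ell2 y z"
  by (simp add: cinner_ell2_def plus_ell2.rep_eq distrib_right infsum_add cinner_ell2_summable)

lemma cinner_ell2_scaleC_left: "cinner_ell2 (scaleC_ell2 c x) y = cnj c * cinner_ell2 x y"
  by (simp add: cinner_ell2_def scaleC_ell2.rep_eq mult.assoc infsum_cmult_right'
      cinner_ell2_summable)

lemma cinner_ell2_commute: "cinner_ell2 x y = cnj (cinner_ell2 y x)"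
proof -
  have "cnj (cinner_ell2 y x) = (\<Sum>\<^sub>\<infinity>i. cnj (cnj (ell2_fun y i) * ell2_fun x i))"
    unfolding cinner_ell2_def by (rule infsum_cnj[symmetric])
  also have "\<dots> = cinner_ell2 x y"
    unfolding cinner_ell2_def by (intro infsum_cong) (simp add: mult.commute)
  finally show ?thesis by simp
qed

lemma cinner_ell2_self:
  "cinner_ell2 x x = complex_of_real (\<Sum>\<^sub>\<infinity>i. (cmod (ell2_fun x i))\<^sup>2)"
proof -
  have "cinner_ell2 x x = (\<Sum>\<^sub>\<infinity>i. complex_of_real ((cmod (ell2_fun x i))\<^sup>2))"
    unfolding cinner_ell2_def
    by (intro infsum_cong) (simp add: complex_norm_square mult.commute del: of_real_power)
  also have "\<dots> = complex_of_real (\<Sum>\<^sub>\<infinity>i. (cmod (ell2_fun x i))\<^sup>2)"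
    by (intro infsumI) (simp only: has_sum_of_real_iff has_sum_infsum ell2_summable)
  finally show ?thesis .
qed

instance
proof
  fix x y z :: "'a ell2" and a b r :: real
  show "x + y + z = x + (y + z)" by transfer (simp add: add.assoc)
  show "x + y = y + x" by transfer (simp add: add.commute)
  show "0 + x = x" by transfer simp
  show "- x + x = 0" by transfer simp
  show "x - y = x + - y" by transfer simp
  show "a *\<^sub>R (x + y) = a *\<^sub>R x + a *\<^sub>R y"
    unfolding scaleR_ell2_def by transfer (simp add: distrib_left)
  show "(a + b) *\<^sub>R x = a *\<^sub>R x + b *\<^sub>R x"
    unfolding scaleR_ell2_def by transfer (simp add: distrib_right)
  show "a *\<^sub>R b *\<^sub>R x = (a * b) *\<^sub>R x"
    unfolding scaleR_ell2_def by transfer (simp add: mult.assoc)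
  show "1 *\<^sub>R x = x" unfolding scaleR_ell2_def by transfer simp
  show "dist x y = norm (x - y)" by (rule dist_ell2_def)
  show "sgn x = inverse (norm x) *\<^sub>R x" by (rule sgn_ell2_def)
  show "uniformity = (INF e\<in>{0 <..}. principal {(x :: 'a ell2, y). dist x y < e})"
    by (rule uniformity_ell2_def)
  show "open U = (\<forall>x\<in>U. \<forall>\<^sub>F (x', y) in uniformity. x' = x \<longrightarrow> y \<in> U)" for U :: "'a ell2 set"
    by (rule open_ell2_def)
  show "inner x y = inner y x"
    unfolding inner_ell2_def cinner_ell2_commute[of x y] by simp
  show "inner (x + y) z = inner x z + inner y z"
    by (simp add: inner_ell2_def cinner_ell2_add_left)
  show "inner (r *\<^sub>R x) y = r * inner x y"
    by (simp add: inner_ell2_def scaleR_ell2_def cinner_ell2_scaleC_left)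
  show "0 \<le> inner x x"
    by (simp add: inner_ell2_def cinner_ell2_self infsum_nonneg)
  show "inner x x = 0 \<longleftrightarrow> x = 0"
  proof
    assume "inner x x = 0"
    then have "(\<Sum>\<^sub>\<infinity>i. (cmod (ell2_fun x i))\<^sup>2) = 0"
      by (simp add: inner_ell2_def cinner_ell2_self)
    then have "(cmod (ell2_fun x i))\<^sup>2 = 0" for i
      using nonneg_infsum_le_0D[of "\<lambda>i. (cmod (ell2_fun x i))\<^sup>2" UNIV i] ell2_summable[of x] by simp
    then show "x = 0" by transfer auto
  next
    assume "x = 0"
    then show "inner x x = 0"
      by (simp add: inner_ell2_def cinner_ell2_def zero_ell2.rep_eq)
  qed
  show "norm x = sqrt (inner x x)"
    by (simp add: norm_ell2_def inner_ell2_def cinner_ell2_self)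
qed

end


section \<open>Bounded operators and their spectrum\<close>

definition bounded_clinear :: "('a ell2 \<Rightarrow> 'b ell2) \<Rightarrow> bool" where
  "bounded_clinear T \<longleftrightarrow>
     bounded_linear T \<and> (\<forall>c x. T (scaleC_ell2 c x) = scaleC_ell2 c (T x))"

definition self_adjoint :: "('a ell2 \<Rightarrow> 'a ell2) \<Rightarrow> bool" where
  "self_adjoint T \<longleftrightarrow> (\<forall>x y. cinner_ell2 (T x) y = cinner_ell2 x (T y))"

definition spectrum :: "('a ell2 \<Rightarrow> 'a ell2) \<Rightarrow> complex set" where
  "spectrum T = {z. \<not> (\<exists>S. bounded_clinear S \<and>
     (\<forall>x. S (T x - scaleC_ell2 z x) = x) \<and> (\<forall>x. T (S x) - scaleC_ell2 z (S x) = x))}"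


section \<open>The Thue-Morse Hamiltonian\<close>

lemma bij_shift: "bij (\<lambda>n :: int. n + k)"
  by (rule bij_betw_byWitness[of _ "\<lambda>n. n - k"]) auto

lemma infsum_shift: "(\<Sum>\<^sub>\<infinity>n. f (n + k)) = (\<Sum>\<^sub>\<infinity>n. f n)" for k :: int
  by (rule infsum_reindex_bij_betw[OF bij_shift])

lemma sq_summable_shift:
  fixes f :: "int \<Rightarrow> complex"
  assumes "(\<lambda>n. (cmod (f n))\<^sup>2) summable_on UNIV"
  shows "(\<lambda>n. (cmod (f (n + k)))\<^sup>2) summable_on UNIV"
  using assms summable_on_reindex_bij_betw[OF bij_shift, of "\<lambda>n. (cmod (f n))\<^sup>2" k] by simp

lift_definition tm_hamiltonian :: "real \<Rightarrow> int ell2 \<Rightarrow> int ell2" is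
  "\<lambda>lam psi n. psi (n + 1) + psi (n - 1) + complex_of_real (lam * thue_morse n) * psi n"
proof -
  fix lam :: real and psi :: "int \<Rightarrow> complex"
  assume psi: "(\<lambda>n. (cmod (psi n))\<^sup>2) summable_on UNIV"
  have "(\<lambda>n. (cmod (complex_of_real (lam * thue_morse n) * psi n))\<^sup>2) summable_on UNIV"
    by (rule sq_summable_bounded_mult[OF psi, of _ "\<bar>lam\<bar>"]) (simp add: norm_mult)
  then show "(\<lambda>n. (cmod (psi (n + 1) + psi (n - 1)
      + complex_of_real (lam * thue_morse n) * psi n))\<^sup>2) summable_on UNIV"
    using sq_summable_shift[OF psi, of 1] sq_summable_shift[OF psi, of "- 1"]
    by (intro sq_summable_add) auto
qed

lift_definition ell2_shift :: "int \<Rightarrow> int ell2 \<Rightarrow> int ell2" is "\<lambda>k psi n. psi (n + k)"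
  by (rule sq_summable_shift)

lift_definition tm_potential :: "int ell2 \<Rightarrow> int ell2" is
  "\<lambda>psi n. complex_of_real (thue_morse n) * psi n"
  by (rule sq_summable_bounded_mult[where K = 1]) auto

lemma norm_ell2_shift: "norm (ell2_shift k x) = norm x"
  by (simp add: norm_ell2_def ell2_shift.rep_eq infsum_shift[of "\<lambda>n. (cmod (ell2_fun x n))\<^sup>2"])

lemma norm_tm_potential: "norm (tm_potential x) = norm x"
  by (simp add: norm_ell2_def tm_potential.rep_eq norm_mult)

lemma tm_hamiltonian_eq:
  "tm_hamiltonian lam x = ell2_shift 1 x + ell2_shift (- 1) x + lam *\<^sub>R tm_potential x"
  unfolding scaleR_ell2_def by transfer (simp add: mult.assoc)

lemma bounded_clinear_tm_hamiltonian: "bounded_clinear (tm_hamiltonian lam)"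
  unfolding bounded_clinear_def
proof (intro conjI allI)
  show "bounded_linear (tm_hamiltonian lam)"
  proof (rule bounded_linear_intro)
    show "tm_hamiltonian lam (x + y) = tm_hamiltonian lam x + tm_hamiltonian lam y" for x y
      by transfer (simp add: algebra_simps)
    show "tm_hamiltonian lam (r *\<^sub>R x) = r *\<^sub>R tm_hamiltonian lam x" for r x
      unfolding scaleR_ell2_def by transfer (simp add: algebra_simps)
    show "norm (tm_hamiltonian lam x) \<le> norm x * (2 + \<bar>lam\<bar>)" for x
    proof -
      have "norm (tm_hamiltonian lam x)
          \<le> norm (ell2_shift 1 x) + norm (ell2_shift (- 1) x) + norm (lam *\<^sub>R tm_potential x)"
        unfolding tm_hamiltonian_eq by (intro norm_triangle_le add_mono order.refl)
      then show ?thesis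
        by (simp add: norm_ell2_shift norm_tm_potential algebra_simps)
    qed
  qed
  show "tm_hamiltonian lam (scaleC_ell2 c x) = scaleC_ell2 c (tm_hamiltonian lam x)" for c x
    by transfer (simp add: algebra_simps)
qed

lemma cinner_ell2_shift: "cinner_ell2 (ell2_shift k x) y = cinner_ell2 x (ell2_shift (- k) y)"
  using infsum_shift[of "\<lambda>n. cnj (ell2_fun x n) * ell2_fun y (n - k)" k]
  by (simp add: cinner_ell2_def ell2_shift.rep_eq)

lemma cinner_tm_potential: "cinner_ell2 (tm_potential x) y = cinner_ell2 x (tm_potential y)"
  by (simp add: cinner_ell2_def tm_potential.rep_eq ac_simps)

lemma self_adjoint_tm_hamiltonian: "self_adjoint (tm_hamiltonian lam)"
proof -
  have R: "cinner_ell2 z (x + y) = cinner_ell2 z x + cinner_ell2 z y" for x y z :: "int ell2"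
    by (simp add: cinner_ell2_def plus_ell2.rep_eq distrib_left infsum_add cinner_ell2_summable)
  have S: "cinner_ell2 x (scaleC_ell2 c y) = c * cinner_ell2 x y" for c and x y :: "int ell2"
    by (simp add: cinner_ell2_def scaleC_ell2.rep_eq mult.left_commute infsum_cmult_right'
        cinner_ell2_summable)
  show ?thesis
    unfolding self_adjoint_def tm_hamiltonian_eq scaleR_ell2_def
    by (simp only: cinner_ell2_add_left R cinner_ell2_scaleC_left S cinner_ell2_shift
        cinner_tm_potential complex_cnj_complex_of_real minus_minus) (simp add: ac_simps)
qed


section \<open>Hausdorff dimension\<close>

text \<open>
  The two exceptional cases of \<open>(diam U)\<^sup>s\<close> implement \<open>0\<^sup>0 = 1\<close> for nonempty \<open>U\<close>
  (so that \<open>s = 0\<close> gives the counting measure), whereas \<open>0 powr 0 = 0\<close>.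
\<close>

definition diam_pow :: "real \<Rightarrow> 'a::metric_space set \<Rightarrow> ennreal" where
  "diam_pow s U = (if U = {} then 0 else if s = 0 then 1 else ennreal (diameter U powr s))"

text \<open>
  Boundedness of the covering sets is required because \<^const>\<open>diameter\<close> is real-valued and
  unspecified on unbounded sets. Finite covers are included, since the sets may be empty.
\<close>

definition hausdorff_premeasure :: "real \<Rightarrow> real \<Rightarrow> 'a::metric_space set \<Rightarrow> ennreal" where
  "hausdorff_premeasure s \<delta> A =
     (INF U\<in>{U :: nat \<Rightarrow> 'a set. A \<subseteq> (\<Union>i. U i) \<and> (\<forall>i. bounded (U i) \<and> diameter (U i) \<le> \<delta>)}.
        \<Sum>i. diam_pow s (U i))"

definition hausdorff_measure :: "real \<Rightarrow> 'a::metric_space set \<Rightarrow> ennreal" where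
  "hausdorff_measure s A = (SUP \<delta>\<in>{0<..}. hausdorff_premeasure s \<delta> A)"

definition hausdorff_dim :: "'a::metric_space set \<Rightarrow> ennreal" where
  "hausdorff_dim A = Inf (ennreal ` {s. 0 \<le> s \<and> hausdorff_measure s A = 0})"

end

theory Submission
  imports Defs
begin

text \<open>
  Let \<open>x\<^sub>n(E)\<close> be the trace of the transfer matrix over the \<open>n\<close>-th Thue-Morse block. If \<open>x\<^sub>n(E) = 0\<close>,
  both block matrices square to \<open>-1\<close>, so the matrices over all longer blocks \<open>abba\<close>, \<open>baab\<close> are the
  identity; truncating the resulting recurrent solution gives Weyl sequences, and \<open>E\<close> lies in the
  spectrum. Hence limits of zeros of traces lie in the spectrum.

  The defect \<open>d\<^sub>n = x\<^sub>n\<^sub>+\<^sub>1 - x\<^sub>n\<^sup>2 + 2\<close> satisfies \<open>d\<^sub>n\<^sub>+\<^sub>1 = (2 - x\<^sub>n\<^sub>+\<^sub>1) d\<^sub>n\<close>. While the traces stay close to \<open>2\<close>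
  it shrinks, so near a zero of \<open>x\<^sub>0\<close> the traces soon follow the Chebyshev map \<open>x \<mapsto> x\<^sup>2 - 2\<close>, whatever
  the coupling. An intermediate value argument then produces a binary tree of nested segments: each
  one splits after six steps into two that are distinguished by the sign of a trace and on which the
  defect is again at most \<open>1\<close>. On these segments all traces are bounded by \<open>3\<close>, so differences of
  traces grow at most like \<open>12\<^sup>n\<close>, which separates the segments of depth \<open>k\<close> by \<open>c 12\<^sup>-\<^sup>6\<^sup>k\<close>. Only \<open>c\<close> depends
  on the coupling, so the dimension is at least \<open>ln 2 / (6 ln 12)\<close>.
\<close>

section \<open>Lower bounds for the Hausdorff dimension\<close>

lemma hausdorff_dim_ge:
  fixes A :: "'a::metric_space set" and f :: "real \<Rightarrow> 'a"
  assumes C: "0 < C" and K: "0 < K" and fA: "f ` {0..<1} \<subseteq> A"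
    and exp: "\<And>x y. x \<in> {0..<1} \<Longrightarrow> y \<in> {0..<1} \<Longrightarrow> \<bar>x - y\<bar> \<le> K * dist (f x) (f y) powr C"
  shows "ennreal C \<le> hausdorff_dim A"
  unfolding hausdorff_dim_def
proof (rule Inf_greatest, clarify)
  fix s :: real assume s: "0 \<le> s" and null: "hausdorff_measure s A = 0"
  show "ennreal C \<le> ennreal s"
  proof (rule ccontr)
    assume "\<not> ennreal C \<le> ennreal s"
    then have "s < C" using ennreal_leI linorder_not_le by blast
    have "ennreal (1 / K) \<le> hausdorff_premeasure s 1 A"
      unfolding hausdorff_premeasure_def
    proof (rule INF_greatest, clarify)
      fix U :: "nat \<Rightarrow> 'a set"
      assume cover: "A \<subseteq> (\<Union>i. U i)" and U: "\<forall>i. bounded (U i) \<and> diameter (U i) \<le> 1"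
      define V where "V i = {x \<in> {0..<1}. f x \<in> U i}" for i
      define l where "l i = (if V i = {} then 0 else K * diameter (U i) powr C)" for i
      define J where "J i = (if V i = {} then {} else {Inf (V i)..Inf (V i) + l i})" for i
      have l0: "0 \<le> l i" for i using K by (simp add: l_def)
      have VJ: "V i \<subseteq> J i" for i
      proof
        fix x assume x: "x \<in> V i"
        have bdd: "bdd_below (V i)" by (rule bdd_belowI[of _ 0]) (auto simp: V_def)
        have "x - l i \<le> y" if y: "y \<in> V i" for y
        proof -
          have "dist (f x) (f y) \<le> diameter (U i)"
            using U x y by (intro diameter_bounded_bound) (auto simp: V_def)
          then have "K * dist (f x) (f y) powr C \<le> l i"
            using x K C by (auto simp: l_def intro!: powr_mono2 mult_left_mono)
          then show ?thesis using exp[of x y] x y by (auto simp: V_def)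
        qed
        then have "x - l i \<le> Inf (V i)" using x by (intro cInf_greatest) auto
        then show "x \<in> J i" using x cInf_lower[OF x bdd] by (auto simp: J_def)
      qed
      have Jm: "J i \<in> sets lborel" for i by (simp add: J_def)
      have term_le: "emeasure lborel (J i) \<le> ennreal K * diam_pow s (U i)" for i
      proof (cases "V i = {}")
        case True
        then show ?thesis by (simp add: J_def)
      next
        case False
        then have ne: "U i \<noteq> {}" by (auto simp: V_def)
        have d0: "0 \<le> diameter (U i)" using U by (simp add: diameter_ge_0)
        have "ennreal (diameter (U i) powr C) \<le> diam_pow s (U i)"
        proof (cases "s = 0")
          case True
          have "diameter (U i) powr C \<le> 1 powr C" using U d0 C by (intro powr_mono2) auto
          then show ?thesis using True ne by (simp add: diam_pow_def)
        next
          case False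
          have "diameter (U i) powr C \<le> diameter (U i) powr s"
            using U d0 \<open>s < C\<close> by (intro powr_mono') auto
          then show ?thesis using False ne by (simp add: diam_pow_def ennreal_leI)
        qed
        then have "ennreal K * ennreal (diameter (U i) powr C) \<le> ennreal K * diam_pow s (U i)"
          by (rule mult_left_mono) simp
        then show ?thesis using False K by (simp add: J_def l_def ennreal_mult)
      qed
      have "{0..<1} \<subseteq> (\<Union>i. V i)" using cover fA by (force simp: V_def)
      then have sub: "{0..<1} \<subseteq> (\<Union>i. J i)" using VJ by blast
      have "1 = emeasure lborel {0..<1::real}" by simp
      also have "\<dots> \<le> emeasure lborel (\<Union>i. J i)"
        using sub Jm by (intro emeasure_mono) auto
      also have "\<dots> \<le> (\<Sum>i. emeasure lborel (J i))"
        using Jm by (intro emeasure_subadditive_countably) auto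
      also have "\<dots> \<le> (\<Sum>i. ennreal K * diam_pow s (U i))"
        by (intro suminf_le term_le) auto
      also have "\<dots> = ennreal K * (\<Sum>i. diam_pow s (U i))" by simp
      finally have "ennreal (1 / K) * 1 \<le> ennreal (1 / K) * (ennreal K * (\<Sum>i. diam_pow s (U i)))"
        by (rule mult_left_mono) simp
      also have "\<dots> = (\<Sum>i. diam_pow s (U i))"
        using K by (simp add: mult.assoc[symmetric] ennreal_mult[symmetric])
      finally show "ennreal (1 / K) \<le> (\<Sum>i. diam_pow s (U i))" by simp
    qed
    also have "\<dots> \<le> hausdorff_measure s A"
      unfolding hausdorff_measure_def by (rule SUP_upper) simp
    finally show False using null K by simp
  qed
qed

definition binary_digit :: "real \<Rightarrow> nat \<Rightarrow> bool" where
  "binary_digit x k \<longleftrightarrow> odd \<lfloor>2 ^ Suc k * x\<rfloor>"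

lemma floor_double_cases: "\<lfloor>2 * x\<rfloor> = 2 * \<lfloor>x\<rfloor> + (if odd \<lfloor>2 * x\<rfloor> then 1 else 0)" for x :: real
proof -
  have "\<lfloor>2 * x\<rfloor> = 2 * \<lfloor>x\<rfloor> \<or> \<lfloor>2 * x\<rfloor> = 2 * \<lfloor>x\<rfloor> + 1" by linarith
  then show ?thesis by auto
qed

lemma binary_digits_close:
  assumes "x \<in> {0..<1}" "y \<in> {0..<1}" "\<And>i. i < k \<Longrightarrow> binary_digit x i = binary_digit y i"
  shows "\<bar>x - y\<bar> < 1 / 2 ^ k"
proof -
  have "\<lfloor>2 ^ k * x\<rfloor> = \<lfloor>2 ^ k * y\<rfloor>"
    using assms(3)
  proof (induction k)
    case 0
    have "\<lfloor>x\<rfloor> = 0" "\<lfloor>y\<rfloor> = 0" using assms(1,2) by (simp_all add: floor_eq_iff)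
    then show ?case by simp
  next
    case (Suc k)
    then show ?case
      using floor_double_cases[of "2 ^ k * x"] floor_double_cases[of "2 ^ k * y"]
        Suc.prems[of k]
      by (simp add: binary_digit_def mult.assoc)
  qed
  then have "\<bar>2 ^ k * x - 2 ^ k * y\<bar> < 1" by linarith
  then have "2 ^ k * \<bar>x - y\<bar> < 1"
    by (metis abs_mult abs_numeral power_abs right_diff_distrib)
  then show ?thesis by (simp add: field_simps)
qed

lemma hausdorff_dim_ge_of_coding:
  fixes A :: "'a::metric_space set" and p :: "(nat \<Rightarrow> bool) \<Rightarrow> 'a"
  assumes r: "0 < c" "1 < r" and pA: "\<And>w. p w \<in> A"
    and sep: "\<And>w w' k. (\<And>i. i < k \<Longrightarrow> w i = w' i) \<Longrightarrow> w k \<noteq> w' k \<Longrightarrow> c / r ^ k \<le> dist (p w) (p w')"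
  shows "ennreal (ln 2 / ln r) \<le> hausdorff_dim A"
proof (rule hausdorff_dim_ge[where f = "\<lambda>x. p (binary_digit x)" and K = "(1 / c) powr (ln 2 / ln r)"])
  let ?C = "ln 2 / ln r"
  show "0 < ?C" using r by simp
  show "0 < (1 / c) powr ?C" using r by simp
  show "(\<lambda>x. p (binary_digit x)) ` {0..<1} \<subseteq> A" using pA by auto
  fix x y :: real assume xy: "x \<in> {0..<1}" "y \<in> {0..<1}"
  show "\<bar>x - y\<bar> \<le> (1 / c) powr ?C * dist (p (binary_digit x)) (p (binary_digit y)) powr ?C"
  proof (cases "binary_digit x = binary_digit y")
    case True
    have "\<bar>x - y\<bar> < e" if "e > 0" for e
    proof -
      obtain k where "1 / 2 ^ k < e"
        using real_arch_pow_inv[of e "1/2"] \<open>e > 0\<close> by (auto simp: power_divide)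
      then show ?thesis using binary_digits_close[OF xy, of k] True by simp
    qed
    from this[of "\<bar>x - y\<bar>"] have "x = y" by linarith
    then show ?thesis by simp
  next
    case False
    then have ex: "\<exists>k. binary_digit x k \<noteq> binary_digit y k" by auto
    define k where "k = (LEAST k. binary_digit x k \<noteq> binary_digit y k)"
    have k: "binary_digit x k \<noteq> binary_digit y k" unfolding k_def using ex by (rule LeastI_ex)
    have lt: "binary_digit x i = binary_digit y i" if "i < k" for i
      using not_less_Least[of i] that unfolding k_def by blast
    let ?D = "dist (p (binary_digit x)) (p (binary_digit y))"
    have "1 / r ^ k \<le> 1 / c * ?D"
      using sep[of k "binary_digit x" "binary_digit y", OF lt k] r by (simp add: field_simps)
    then have "(1 / r ^ k) powr ?C \<le> (1 / c * ?D) powr ?C"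
      using r by (intro powr_mono2) auto
    moreover have "(1 / r ^ k) powr ?C = 1 / 2 ^ k"
    proof -
      have "(1 / r ^ k) powr ?C = exp (?C * ln (1 / r ^ k))" using r by (simp add: powr_def)
      also have "ln (1 / r ^ k) = - (real k * ln r)" using r by (simp add: ln_div ln_realpow)
      also have "?C * - (real k * ln r) = - (real k * ln 2)" using r by simp
      also have "exp (- (real k * ln 2)) = 1 / 2 ^ k"
        by (simp add: exp_minus exp_of_nat_mult field_simps)
      finally show ?thesis .
    qed
    moreover have "\<bar>x - y\<bar> < 1 / 2 ^ k" using binary_digits_close[OF xy lt] .
    moreover have "(1 / c * ?D) powr ?C = (1 / c) powr ?C * ?D powr ?C"
      by (rule powr_mult)
    ultimately show ?thesis by linarith
  qed
qed


section \<open>Zeros of the traces lie in the spectrum\<close>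

fun trace_seq :: "real \<Rightarrow> nat \<Rightarrow> real \<Rightarrow> real" where
  "trace_seq lam 0 E = E\<^sup>2 - lam\<^sup>2 - 2"
| "trace_seq lam (Suc 0) E = (E\<^sup>2 - lam\<^sup>2 - 2)\<^sup>2 - 2 - 4 * lam\<^sup>2"
| "trace_seq lam (Suc (Suc n)) E =
     (trace_seq lam n E)\<^sup>2 * (trace_seq lam (Suc n) E - 2) + 2"

definition transfer_matrix :: "real \<Rightarrow> real \<Rightarrow> letter \<Rightarrow> real^2^2" where
  "transfer_matrix lam E c = vector [vector [E - lam * (if c = LA then 1 else - 1), - 1], vector [1, 0]]"

fun monodromy :: "real \<Rightarrow> real \<Rightarrow> letter list \<Rightarrow> real^2^2" where
  "monodromy lam E [] = mat 1"
| "monodromy lam E (c # w) = monodromy lam E w ** transfer_matrix lam E c"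

lemma monodromy_append: "monodromy lam E (w @ w') = monodromy lam E w' ** monodromy lam E w"
  by (induction w) (simp_all add: matrix_mul_assoc)

lemma det_transfer_matrix: "det (transfer_matrix lam E c) = 1"
  by (simp add: transfer_matrix_def det_2)

lemma det_monodromy: "det (monodromy lam E w) = 1"
  by (induction w) (simp_all add: det_mul det_transfer_matrix)

lemma square_matrix2: "A ** A = trace A *\<^sub>R A - det A *\<^sub>R mat 1" for A :: "real^2^2"
  by (simp add: vec_eq_iff forall_2 matrix_matrix_mult_def sum_2 trace_def det_2 mat_def algebra_simps)

lemma trace_square_mult_square:
  fixes A B :: "real^2^2"
  assumes "det A = 1" "det B = 1" "trace A = t" "trace B = t"
  shows "trace ((A ** A) ** (B ** B)) = t\<^sup>2 * (trace (A ** B) - 2) + 2"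
proof -
  have "(A ** A) ** (B ** B) = (t *\<^sub>R A - mat 1) ** (t *\<^sub>R B - mat 1)"
    using assms by (simp add: square_matrix2)
  also have "trace \<dots> = t\<^sup>2 * trace (A ** B) - t * trace A - t * trace B + 2"
    by (simp add: matrix_matrix_mult_def sum_2 trace_def mat_def power2_eq_square algebra_simps)
  finally show ?thesis using assms by (simp add: power2_eq_square algebra_simps)
qed

abbreviation tm_monodromy :: "real \<Rightarrow> real \<Rightarrow> nat \<Rightarrow> letter \<Rightarrow> real^2^2" where
  "tm_monodromy lam E n c \<equiv> monodromy lam E ((tm_subst ^^ n) [c])"

lemma tm_subst_pow_append: "(tm_subst ^^ n) (w @ w') = (tm_subst ^^ n) w @ (tm_subst ^^ n) w'"
  by (induction n) (simp_all add: tm_subst_append)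

lemma tm_monodromy_Suc:
  "tm_monodromy lam E (Suc n) LA = tm_monodromy lam E n LB ** tm_monodromy lam E n LA"
  "tm_monodromy lam E (Suc n) LB = tm_monodromy lam E n LA ** tm_monodromy lam E n LB"
  using tm_subst_pow_append[of n "[LA]" "[LB]"] tm_subst_pow_append[of n "[LB]" "[LA]"]
  by (simp_all only: funpow_Suc_right o_apply) (simp_all add: tm_subst_def monodromy_append)

lemma trace_tm_monodromy:
  "trace (tm_monodromy lam E (Suc n) LA) = trace_seq lam n E \<and>
   trace (tm_monodromy lam E (Suc n) LB) = trace_seq lam n E"
proof (induction lam n E rule: trace_seq.induct)
  case (1 lam E)
  show ?case
    by (simp add: tm_monodromy_Suc del: funpow.simps(2))
      (simp add: transfer_matrix_def matrix_matrix_mult_def sum_2 trace_def power2_eq_square algebra_simps)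
next
  case (2 lam E)
  show ?case
    by (simp add: tm_monodromy_Suc del: funpow.simps(2))
      (simp add: transfer_matrix_def matrix_matrix_mult_def sum_2 trace_def power2_eq_square algebra_simps)
next
  case (3 lam n E)
  let ?A = "tm_monodromy lam E (Suc n) LA" and ?B = "tm_monodromy lam E (Suc n) LB"
  have "tm_monodromy lam E (Suc (Suc (Suc n))) LA = (?A ** ?B) ** (?B ** ?A)"
    "tm_monodromy lam E (Suc (Suc (Suc n))) LB = (?B ** ?A) ** (?A ** ?B)"
    by (simp_all only: tm_monodromy_Suc)
  moreover have "trace ((?A ** ?B) ** (?B ** ?A)) = trace ((?A ** ?A) ** (?B ** ?B))"
    "trace ((?B ** ?A) ** (?A ** ?B)) = trace ((?A ** ?A) ** (?B ** ?B))"
    by (metis trace_mul_sym matrix_mul_assoc)+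
  moreover have "trace (?A ** ?B) = trace_seq lam (Suc n) E"
    using 3(2) by (simp only: tm_monodromy_Suc)
  ultimately show ?case
    using trace_square_mult_square[of ?A ?B "trace_seq lam n E"] 3(1)
    by (simp add: det_monodromy del: funpow.simps(2))
qed

lemma tm_monodromy_eq_mat_1:
  assumes "trace_seq lam n E = 0"
  shows "tm_monodromy lam E (n + 3) c = mat 1"
proof -
  let ?A = "tm_monodromy lam E (Suc n) LA" and ?B = "tm_monodromy lam E (Suc n) LB"
  have A: "?A ** ?A = - mat 1" and B: "?B ** ?B = - mat 1"
    unfolding square_matrix2 using trace_tm_monodromy[of lam E n] assms
    by (simp_all add: det_monodromy del: funpow.simps(2))
  have neg: "P ** (- mat 1) = - P" "(- P) ** Q = - (P ** Q)" for P Q :: "real^2^2"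
    by (simp_all add: vec_eq_iff forall_2 matrix_matrix_mult_def sum_2 mat_def)
  have n3: "n + 3 = Suc (Suc (Suc n))" by simp
  have "tm_monodromy lam E (n + 3) LA = ?A ** (?B ** ?B) ** ?A"
    "tm_monodromy lam E (n + 3) LB = ?B ** (?A ** ?A) ** ?B"
    unfolding n3 by (simp_all only: tm_monodromy_Suc matrix_mul_assoc)
  then show ?thesis
    using A B by (cases c) (simp_all add: neg del: funpow.simps(2))
qed

lemma monodromy_tm_subst_pow:
  assumes "\<And>c. tm_monodromy lam E N c = mat 1"
  shows "monodromy lam E ((tm_subst ^^ N) w) = mat 1"
proof (induction w)
  case Nil
  have "(tm_subst ^^ N) [] = []" by (induction N) (simp_all add: tm_subst_def)
  then show ?case by simp
next
  case (Cons c w)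
  then show ?case
    using tm_subst_pow_append[of N "[c]" w] assms[of c] by (simp add: monodromy_append)
qed

fun half_line_solution :: "real \<Rightarrow> real \<Rightarrow> nat \<Rightarrow> real" where
  "half_line_solution lam E 0 = 0"
| "half_line_solution lam E (Suc 0) = 1"
| "half_line_solution lam E (Suc (Suc j)) =
     (E - lam * thue_morse (int (Suc j))) * half_line_solution lam E (Suc j) - half_line_solution lam E j"

lemma half_line_solution_monodromy:
  assumes "j \<le> 2 ^ m"
  shows "vector [half_line_solution lam E (Suc j), half_line_solution lam E j] =
    monodromy lam E (take j (tm_word m)) *v (vector [1, 0] :: real^2)"
  using assms
proof (induction j)
  case 0
  then show ?case by simp
next
  case (Suc j)
  have len: "j < length (tm_word m)" using Suc.prems by (simp add: length_tm_word)
  have u: "tm_u (Suc j) = tm_word m ! j" using tm_word_nth[of "Suc j" m] len by simp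
  have "monodromy lam E (take (Suc j) (tm_word m)) *v vector [1, 0] =
    transfer_matrix lam E (tm_word m ! j) *v vector [half_line_solution lam E (Suc j), half_line_solution lam E j]"
    using Suc by (simp add: take_Suc_conv_app_nth[OF len] monodromy_append matrix_vector_mul_assoc)
  also have "\<dots> = vector [half_line_solution lam E (Suc (Suc j)), half_line_solution lam E (Suc j)]"
    using thue_morse_pos[of "Suc j"] u
    by (simp add: vec_eq_iff forall_2 matrix_vector_mult_def sum_2 transfer_matrix_def)
  finally show ?case by simp
qed

lemma half_line_solution_periodic:
  assumes "trace_seq lam n E = 0"
  shows "half_line_solution lam E (k * 2 ^ (n + 3)) = 0"
    and "half_line_solution lam E (Suc (k * 2 ^ (n + 3))) = 1"
proof -
  let ?N = "n + 3"
  have len: "length ((tm_subst ^^ i) w) = 2 ^ i * length w" for i w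
    by (induction i) (simp_all add: length_tm_subst)
  have k: "k < 2 ^ k" by simp
  have "tm_word (?N + k) = (tm_subst ^^ ?N) (take k (tm_word k) @ drop k (tm_word k))"
    unfolding tm_word_def by (simp only: funpow_add o_apply append_take_drop_id)
  then have "tm_word (?N + k) = (tm_subst ^^ ?N) (take k (tm_word k)) @ (tm_subst ^^ ?N) (drop k (tm_word k))"
    by (simp only: tm_subst_pow_append)
  then have "take (k * 2 ^ ?N) (tm_word (?N + k)) = (tm_subst ^^ ?N) (take k (tm_word k))"
    using k by (simp add: len length_tm_word del: funpow.simps(2))
  then have "monodromy lam E (take (k * 2 ^ ?N) (tm_word (?N + k))) = mat 1"
    using monodromy_tm_subst_pow[of lam E ?N] tm_monodromy_eq_mat_1[OF assms] by simp
  moreover have "k * 2 ^ ?N \<le> 2 ^ (?N + k)"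
    using k by (simp add: power_add)
  ultimately have "vector [half_line_solution lam E (Suc (k * 2 ^ ?N)), half_line_solution lam E (k * 2 ^ ?N)]
      = (vector [1, 0] :: real^2)"
    by (simp add: half_line_solution_monodromy)
  then show "half_line_solution lam E (k * 2 ^ ?N) = 0" "half_line_solution lam E (Suc (k * 2 ^ ?N)) = 1"
    by (simp_all add: vec_eq_iff forall_2)
qed

definition approx_point_spectrum :: "('a ell2 \<Rightarrow> 'a ell2) \<Rightarrow> complex set" where
  "approx_point_spectrum T = {z. \<forall>e>0. \<exists>x. x \<noteq> 0 \<and> norm (T x - scaleC_ell2 z x) \<le> e * norm x}"

lemma norm_scaleC_ell2: "norm (scaleC_ell2 c x) = cmod c * norm x"
proof -
  have "(\<Sum>\<^sub>\<infinity>i. (cmod (c * ell2_fun x i))\<^sup>2) = (cmod c)\<^sup>2 * (\<Sum>\<^sub>\<infinity>i. (cmod (ell2_fun x i))\<^sup>2)"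
    by (simp add: norm_mult power_mult_distrib infsum_cmult_right')
  then show ?thesis
    by (simp add: norm_ell2_def scaleC_ell2.rep_eq real_sqrt_mult)
qed

lemma approx_point_spectrum_subset: "approx_point_spectrum T \<subseteq> spectrum T"
proof
  fix z assume z: "z \<in> approx_point_spectrum T"
  show "z \<in> spectrum T"
    unfolding spectrum_def
  proof clarify
    fix S assume "bounded_clinear S" and inv: "\<forall>x. S (T x - scaleC_ell2 z x) = x"
    then have "bounded_linear S" by (simp add: bounded_clinear_def)
    then obtain K where K: "K > 0" "\<And>x. norm (S x) \<le> norm x * K"
      using bounded_linear.pos_bounded by blast
    obtain x where x: "x \<noteq> 0" "norm (T x - scaleC_ell2 z x) \<le> 1 / (2 * K) * norm x"
      using z K(1) by (auto simp: approx_point_spectrum_def dest!: spec[of _ "1 / (2 * K)"])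
    have "norm x \<le> norm (T x - scaleC_ell2 z x) * K" using K(2)[of "T x - scaleC_ell2 z x"] inv by simp
    also have "\<dots> \<le> 1 / (2 * K) * norm x * K" using x(2) K(1) by (intro mult_right_mono) auto
    also have "\<dots> = norm x / 2" using K(1) by simp
    finally show False using x(1) by simp
  qed
qed

lemma closed_approx_point_spectrum: "closed (approx_point_spectrum T)"
  unfolding closure_subset_eq[symmetric]
proof
  fix z assume "z \<in> closure (approx_point_spectrum T)"
  then have close: "\<forall>e>0. \<exists>y\<in>approx_point_spectrum T. dist y z < e"
    by (simp add: closure_approachable)
  show "z \<in> approx_point_spectrum T"
    unfolding approx_point_spectrum_def
  proof (intro CollectI allI impI)
    fix e :: real assume e: "e > 0"
    then obtain y where y: "y \<in> approx_point_spectrum T" "dist y z < e / 2"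
      using close half_gt_zero by blast
    then obtain x where x: "x \<noteq> 0" "norm (T x - scaleC_ell2 y x) \<le> e / 2 * norm x"
      using e by (auto simp: approx_point_spectrum_def dest!: spec[of _ "e / 2"])
    have "T x - scaleC_ell2 z x = (T x - scaleC_ell2 y x) + scaleC_ell2 (y - z) x"
      by (simp add: ell2_fun_inject[symmetric] fun_eq_iff plus_ell2.rep_eq minus_ell2.rep_eq
          scaleC_ell2.rep_eq algebra_simps)
    then have "norm (T x - scaleC_ell2 z x) \<le> norm (T x - scaleC_ell2 y x) + cmod (y - z) * norm x"
      by (metis norm_scaleC_ell2 norm_triangle_ineq)
    also have "\<dots> \<le> e / 2 * norm x + e / 2 * norm x"
      using x(2) y(2) by (intro add_mono mult_right_mono) (auto simp: dist_norm)
    finally show "\<exists>x. x \<noteq> 0 \<and> norm (T x - scaleC_ell2 z x) \<le> e * norm x"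
      using x(1) by (auto simp: algebra_simps)
  qed
qed

lift_definition finite_vector :: "nat \<Rightarrow> (nat \<Rightarrow> real) \<Rightarrow> int ell2" is
  "\<lambda>L f i. if i \<in> int ` {..L} then complex_of_real (f (nat i)) else 0"
proof -
  fix L and f :: "nat \<Rightarrow> real"
  have "(\<lambda>i. (cmod (if i \<in> int ` {..L} then complex_of_real (f (nat i)) else 0))\<^sup>2)
    summable_on (int ` {..L})" by (rule summable_on_finite) simp
  then show "(\<lambda>i. (cmod (if i \<in> int ` {..L} then complex_of_real (f (nat i)) else 0))\<^sup>2)
    summable_on UNIV" by (rule summable_on_cong_neutral[THEN iffD1, rotated -1]) auto
qed

lemma zero_trace_in_approx_point_spectrum:
  assumes tr: "trace_seq lam n E = 0"
  shows "complex_of_real E \<in> approx_point_spectrum (tm_hamiltonian lam)"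
  unfolding approx_point_spectrum_def
proof (intro CollectI allI impI)
  fix e :: real assume e: "e > 0"
  let ?f = "half_line_solution lam E" and ?p = "2 ^ (n + 3) :: nat"
  obtain k :: nat where k: "2 / e\<^sup>2 < real k" using reals_Archimedean2 by blast
  have k0: "k > 0" using k e by (intro Nat.gr0I) (auto simp: field_simps)
  define L where "L = k * ?p"
  have L0: "L > 0" using k0 by (simp add: L_def)
  define x where "x = finite_vector L ?f"
  have xi: "ell2_fun x i = (if 0 \<le> i \<and> i \<le> int L then complex_of_real (?f (nat i)) else 0)" for i
  proof -
    have "i \<in> int ` {..L} \<longleftrightarrow> 0 \<le> i \<and> i \<le> int L" by (auto simp: image_iff intro!: bexI[of _ "nat i"])
    then show ?thesis by (simp add: x_def finite_vector.rep_eq)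
  qed
  have fL: "?f L = 0" "?f (Suc L) = 1"
    unfolding L_def using half_line_solution_periodic[OF tr, of k] by simp_all
  have Hi: "ell2_fun (tm_hamiltonian lam x - scaleC_ell2 (complex_of_real E) x) i
      = (if i = 0 then 1 else if i = int L then - 1 else 0)" (is "?H i = _") for i
  proof -
    have H: "?H i = ell2_fun x (i + 1) + ell2_fun x (i - 1)
        + complex_of_real (lam * thue_morse i - E) * ell2_fun x i"
      by (simp add: minus_ell2.rep_eq tm_hamiltonian.rep_eq scaleC_ell2.rep_eq algebra_simps)
    consider "i < 0" | "i = 0" | j where "i = int (Suc j)" "Suc j < L" | "i = int L" | "i = int L + 1"
      | "i > int L + 1"
    proof -
      assume *: "i < 0 \<Longrightarrow> thesis" "i = 0 \<Longrightarrow> thesis" "\<And>j. i = int (Suc j) \<Longrightarrow> Suc j < L \<Longrightarrow> thesis"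
        "i = int L \<Longrightarrow> thesis" "i = int L + 1 \<Longrightarrow> thesis" "i > int L + 1 \<Longrightarrow> thesis"
      show thesis
      proof (cases "0 < i \<and> i < int L")
        case True
        then show ?thesis using *(3)[of "nat (i - 1)"] by auto
      next
        case False
        then show ?thesis using *(1,2,4,5,6) by linarith
      qed
    qed
    then show ?thesis
    proof cases
      case 2
      then have "?H i = 1" using L0 unfolding H by (simp add: xi One_nat_def)
      then show ?thesis using 2 by simp
    next
      case (3 j)
      then have "ell2_fun x (i + 1) = complex_of_real (?f (Suc (Suc j)))"
        "ell2_fun x (i - 1) = complex_of_real (?f j)" "ell2_fun x i = complex_of_real (?f (Suc j))"
        by (simp_all add: xi nat_add_distrib)
      then have "?H i = complex_of_real (?f (Suc (Suc j)) + ?f j + (lam * thue_morse i - E) * ?f (Suc j))"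
        unfolding H by simp
      also have "\<dots> = 0" using 3(1) by (simp add: algebra_simps)
      finally show ?thesis using 3 by simp
    next
      case 4
      obtain j where j: "L = Suc j" using L0 gr0_implies_Suc by blast
      have "?f (Suc (Suc j)) = 1" "?f (Suc j) = 0" using fL j by auto
      then have "?f j = - 1" by (simp only: half_line_solution.simps(3))
      then have "ell2_fun x (i + 1) = 0" "ell2_fun x (i - 1) = - 1"
        using 4 j by (simp_all add: xi)
      moreover have "ell2_fun x i = 0" using 4 fL by (simp add: xi)
      ultimately have "?H i = - 1" unfolding H by simp
      then show ?thesis using 4 L0 by simp
    next
      case 5
      then have "?H i = 0" using fL unfolding H by (simp add: xi)
      then show ?thesis using 5 by simp
    qed (use L0 in \<open>auto simp: H xi\<close>)
  qed
  have "(\<Sum>\<^sub>\<infinity>i. (cmod (?H i))\<^sup>2) = (\<Sum>\<^sub>\<infinity>i\<in>{0, int L}. (cmod (?H i))\<^sup>2)"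
    by (rule infsum_cong_neutral) (auto simp: Hi)
  also have "\<dots> = 2" using L0 by (simp add: Hi)
  finally have normH: "norm (tm_hamiltonian lam x - scaleC_ell2 (complex_of_real E) x) = sqrt 2"
    by (simp add: norm_ell2_def)
  let ?J = "(\<lambda>j. int (Suc (j * ?p))) ` {..<k}"
  have "inj_on (\<lambda>j. int (Suc (j * ?p))) {..<k}" by (auto intro!: inj_onI)
  then have card: "card ?J = k" by (simp add: card_image)
  have one: "ell2_fun x i = 1" if "i \<in> ?J" for i
  proof -
    from that obtain j where j: "j < k" "i = int (Suc (j * ?p))" by blast
    have "Suc j * ?p \<le> L" unfolding L_def using j(1) by (intro mult_right_mono) auto
    moreover have "1 \<le> ?p" by simp
    ultimately have "Suc (j * ?p) \<le> L" by (simp only: mult_Suc)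
    then have "0 \<le> i \<and> i \<le> int L" unfolding j(2) by (simp only: of_nat_le_iff of_nat_0_le_iff simp_thms)
    then show ?thesis using half_line_solution_periodic(2)[OF tr, of j] j(2)
      by (simp only: xi nat_int) simp
  qed
  have "real k = (\<Sum>i\<in>?J. (cmod (ell2_fun x i))\<^sup>2)" using one card by simp
  also have "\<dots> \<le> (\<Sum>\<^sub>\<infinity>i. (cmod (ell2_fun x i))\<^sup>2)"
    by (rule finite_sum_le_infsum[OF ell2_summable]) auto
  finally have normx: "sqrt (real k) \<le> norm x" by (simp add: norm_ell2_def)
  have "2 < e\<^sup>2 * real k" using k e by (simp add: field_simps)
  then have "sqrt 2 \<le> sqrt (e\<^sup>2 * real k)" by (simp only: real_sqrt_le_iff)
  also have "\<dots> = e * sqrt (real k)" using e by (simp add: real_sqrt_mult)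
  also have "\<dots> \<le> e * norm x" using normx e by (intro mult_left_mono) auto
  finally have "norm (tm_hamiltonian lam x - scaleC_ell2 (complex_of_real E) x) \<le> e * norm x"
    using normH by simp
  moreover have "x \<noteq> 0" using normx k0 by auto
  ultimately show "\<exists>x. x \<noteq> 0 \<and>
      norm (tm_hamiltonian lam x - scaleC_ell2 (complex_of_real E) x) \<le> e * norm x" by blast
qed


section \<open>Dynamics of the traces\<close>

text \<open>
  The defect measures the distance of a pair of consecutive traces from the curve \<open>y = x\<^sup>2 - 2\<close>,
  on which the trace map acts as the Chebyshev map.
\<close>

definition defect :: "real \<Rightarrow> nat \<Rightarrow> real \<Rightarrow> real" where
  "defect lam n E = trace_seq lam (Suc n) E - (trace_seq lam n E)\<^sup>2 + 2"

lemma trace_seq_Suc: "trace_seq lam (Suc n) E = (trace_seq lam n E)\<^sup>2 - 2 + defect lam n E"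
  by (simp add: defect_def)

lemma defect_Suc: "defect lam (Suc n) E = (2 - trace_seq lam (Suc n) E) * defect lam n E"
  by (simp add: defect_def power2_eq_square algebra_simps)

lemma continuous_on_trace_seq: "continuous_on S (trace_seq lam n)"
proof (induction lam n "0::real" rule: trace_seq.induct)
  case (1 lam)
  have "trace_seq lam 0 = (\<lambda>E. E\<^sup>2 - lam\<^sup>2 - 2)" by (rule ext) simp
  then show ?case by (auto intro!: continuous_intros)
next
  case (2 lam)
  have "trace_seq lam (Suc 0) = (\<lambda>E. (E\<^sup>2 - lam\<^sup>2 - 2)\<^sup>2 - 2 - 4 * lam\<^sup>2)" by (rule ext) simp
  then show ?case by (auto intro!: continuous_intros)
next
  case (3 lam n)
  have "trace_seq lam (Suc (Suc n)) = (\<lambda>E. (trace_seq lam n E)\<^sup>2 * (trace_seq lam (Suc n) E - 2) + 2)"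
    by (rule ext) simp
  then show ?case using 3 by (auto intro!: continuous_intros)
qed

text \<open>
  The left end point is the positive zero of the initial trace; the right one is the larger zero of
  \<open>E\<^sup>2 - lam\<^sup>2 = 2 E\<close>, where the next trace equals \<open>2\<close>.
\<close>

definition energy_window :: "real \<Rightarrow> real set" where
  "energy_window lam = {sqrt (lam\<^sup>2 + 2)..1 + sqrt (lam\<^sup>2 + 1)}"

lemma compact_energy_window: "compact (energy_window lam)"
  by (simp add: energy_window_def)

lemma closed_segment_energy_window:
  "a \<in> energy_window lam \<Longrightarrow> b \<in> energy_window lam \<Longrightarrow> closed_segment a b \<subseteq> energy_window lam"
  by (rule closed_segment_subset) (simp_all add: energy_window_def)

lemma trace_seq_le_2:
  assumes E: "E \<in> energy_window lam" and "n \<ge> 1"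
  shows "trace_seq lam n E \<le> 2"
proof -
  have E1: "sqrt (lam\<^sup>2 + 2) \<le> E" "E - 1 \<le> sqrt (lam\<^sup>2 + 1)" using E by (simp_all add: energy_window_def)
  have "1 \<le> sqrt (lam\<^sup>2 + 2)" by simp
  then have E0: "1 \<le> E" using E1 by linarith
  have "(sqrt (lam\<^sup>2 + 2))\<^sup>2 \<le> E\<^sup>2" using E1 by (intro power_mono) auto
  then have l: "0 \<le> E\<^sup>2 - lam\<^sup>2" by simp
  have "(E - 1)\<^sup>2 \<le> (sqrt (lam\<^sup>2 + 1))\<^sup>2" using E1 E0 by (intro power_mono) auto
  then have u: "E\<^sup>2 - lam\<^sup>2 \<le> 2 * E" by (simp add: power2_eq_square algebra_simps)
  have sq: "(E\<^sup>2 - lam\<^sup>2)\<^sup>2 \<le> (2 * E)\<^sup>2" using l u by (intro power_mono)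
  have "trace_seq lam (Suc 0) E = (E\<^sup>2 - lam\<^sup>2)\<^sup>2 - (2 * E)\<^sup>2 + 2"
    by (simp add: power2_eq_square algebra_simps)
  then have base: "trace_seq lam (Suc 0) E \<le> 2" using sq by simp
  have "trace_seq lam (Suc m) E \<le> 2" for m
  proof (induction m)
    case (Suc m)
    then have "(trace_seq lam m E)\<^sup>2 * (trace_seq lam (Suc m) E - 2) \<le> 0"
      by (intro mult_nonneg_nonpos) auto
    then show ?case by simp
  qed (rule base)
  from this[of "n - 1"] show ?thesis using \<open>n \<ge> 1\<close> by simp
qed

lemma defect_nonpos:
  assumes E: "E \<in> energy_window lam"
  shows "defect lam n E \<le> 0"
proof (induction n)
  case 0
  show ?case by (simp add: defect_def)
next
  case (Suc n)
  then show ?case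
    using trace_seq_le_2[OF E, of "Suc n"] by (simp add: defect_Suc mult_nonneg_nonpos)
qed

lemma trace_seq_eq_2:
  assumes "trace_seq lam n E = 2" "n \<ge> 1" "m \<ge> n"
  shows "trace_seq lam m E = 2"
  using \<open>m \<ge> n\<close>
proof (induction m rule: dec_induct)
  case (step m)
  then show ?case using \<open>n \<ge> 1\<close> by (cases m) auto
qed (rule assms(1))

lemma trace_seq_zero_imp_2: "trace_seq lam n E = 0 \<Longrightarrow> trace_seq lam (Suc (Suc n)) E = 2"
  by simp

declare trace_seq.simps(3) [simp del]

text \<open>
  If the trace is nonnegative at time \<open>n + 4\<close>, then it was already close to \<open>2\<close> a few steps
  earlier, so the factors \<open>2 - x\<close> by which the defect is multiplied are small.
\<close>

lemma defect_contraction: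
  assumes E: "E \<in> energy_window lam" and nn: "\<And>i. i \<le> 4 \<Longrightarrow> 0 \<le> trace_seq lam (n + i) E"
  shows "\<bar>defect lam (n + 4) E\<bar> \<le> \<bar>defect lam n E\<bar> / 100"
proof -
  let ?x = "\<lambda>i. trace_seq lam (n + i) E"
  have num: "Suc n = n + 1" "Suc (n + 1) = n + 2" "Suc (n + 2) = n + 3" "Suc (n + 3) = n + 4"
    by simp_all
  have "trace_seq lam (Suc m) E + 2 \<le> (trace_seq lam m E)\<^sup>2" for m
    using trace_seq_Suc[of lam m E] defect_nonpos[OF E, of m] by simp
  then have desc: "?x 2 + 2 \<le> (?x 1)\<^sup>2" "?x 3 + 2 \<le> (?x 2)\<^sup>2" "?x 4 + 2 \<le> (?x 3)\<^sup>2"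
    unfolding num[symmetric] by blast+
  have up: "?x i \<le> 2" if "i \<ge> 1" for i using trace_seq_le_2[OF E, of "n + i"] that by simp
  have "1.4 \<le> ?x 3"
    by (rule power2_le_imp_le) (use desc(3) nn[of 4] nn[of 3] in \<open>auto simp: power2_eq_square\<close>)
  then have x3: "2 - ?x 3 \<le> 0.6" by simp
  have "1.84 \<le> ?x 2"
    by (rule power2_le_imp_le) (use desc(2) x3 nn[of 2] in \<open>auto simp: power2_eq_square\<close>)
  then have x2: "2 - ?x 2 \<le> 0.16" by simp
  have "1.95 \<le> ?x 1"
    by (rule power2_le_imp_le) (use desc(1) x2 nn[of 1] in \<open>auto simp: power2_eq_square\<close>)
  then have x1: "2 - ?x 1 \<le> 0.05" by simp
  have x4: "2 - ?x 4 \<le> 2" using nn[of 4] by simp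
  have pos: "0 \<le> 2 - ?x 1" "0 \<le> 2 - ?x 2" "0 \<le> 2 - ?x 3" "0 \<le> 2 - ?x 4"
    using up[of 1] up[of 2] up[of 3] up[of 4] by simp_all
  have "(2 - ?x 4) * (2 - ?x 3) * (2 - ?x 2) * (2 - ?x 1) \<le> 2 * 0.6 * 0.16 * 0.05"
    using pos x1 x2 x3 x4 by (intro mult_mono) auto
  also have "\<dots> \<le> (1 / 100 :: real)" by simp
  finally have le: "(2 - ?x 4) * (2 - ?x 3) * (2 - ?x 2) * (2 - ?x 1) \<le> 1 / 100" .
  have "defect lam (n + 4) E = ((2 - ?x 4) * (2 - ?x 3) * (2 - ?x 2) * (2 - ?x 1)) * defect lam n E"
    using defect_Suc[of lam "n + 3" E] defect_Suc[of lam "n + 2" E] defect_Suc[of lam "n + 1" E]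
      defect_Suc[of lam n E] unfolding num by simp
  then have "\<bar>defect lam (n + 4) E\<bar> =
      ((2 - ?x 4) * (2 - ?x 3) * (2 - ?x 2) * (2 - ?x 1)) * \<bar>defect lam n E\<bar>"
    using pos by (simp add: abs_mult)
  also have "\<dots> \<le> (1 / 100) * \<bar>defect lam n E\<bar>" using le by (rule mult_right_mono) simp
  finally show ?thesis by simp
qed

lemma first_zero_on_segment:
  fixes f :: "real \<Rightarrow> real"
  assumes cont: "continuous_on (closed_segment a b) f" and fa: "0 < f a" and fb: "f b \<le> 0"
  obtains c where "c \<in> closed_segment a b" "f c = 0" "\<And>t. t \<in> closed_segment a c \<Longrightarrow> 0 \<le> f t"
proof -
  define T where "T = closed_segment a b \<inter> f -` {..0}"
  have "closed T" unfolding T_def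
    by (intro continuous_closed_preimage cont) auto
  then have "compact T" unfolding T_def
    by (metis bounded_Int bounded_closed_segment compact_eq_bounded_closed)
  moreover have "b \<in> T" using fb by (simp add: T_def)
  moreover have "continuous_on T (\<lambda>t. \<bar>t - a\<bar>)" by (intro continuous_intros)
  ultimately obtain c where c: "c \<in> T" and min: "\<And>t. t \<in> T \<Longrightarrow> \<bar>c - a\<bar> \<le> \<bar>t - a\<bar>"
    using continuous_attains_inf[of T "\<lambda>t. \<bar>t - a\<bar>"] by blast
  have cab: "c \<in> closed_segment a b" using c by (simp add: T_def)
  then have sub: "closed_segment a c \<subseteq> closed_segment a b"
    by (simp add: subset_closed_segment)
  have only: "t = c" if "t \<in> closed_segment a c" "f t \<le> 0" for t
    using min[of t] sub that by (auto simp: T_def closed_segment_eq_real_ivl split: if_splits)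
  have "continuous_on (closed_segment a c) f" using cont sub by (rule continuous_on_subset)
  then have "\<exists>t\<in>closed_segment a c. f t = 0"
    using IVT'[of f c 0 a] IVT2'[of f c 0 a] c fa
    by (auto simp: T_def closed_segment_eq_real_ivl split: if_splits)
  then obtain t where "t \<in> closed_segment a c" "f t = 0" by blast
  with only[of t] have "f c = 0" by auto
  then have "\<And>t. t \<in> closed_segment a c \<Longrightarrow> 0 \<le> f t" using only by (metis linear)
  with \<open>f c = 0\<close> cab that show ?thesis by blast
qed

text \<open>Segments are oriented: \<open>b < a\<close> is allowed and does occur after a turn.\<close>

definition crossing :: "real \<Rightarrow> nat \<Rightarrow> real \<Rightarrow> real \<Rightarrow> bool" where
  "crossing lam n a b \<longleftrightarrow> n \<ge> 1 \<and> a \<in> energy_window lam \<and> b \<in> energy_window lam \<and>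
     trace_seq lam n a = 2 \<and> trace_seq lam n b = 0 \<and>
     (\<forall>E\<in>closed_segment a b. 0 \<le> trace_seq lam n E)"

lemma crossing_window: "crossing lam n a b \<Longrightarrow> E \<in> closed_segment a b \<Longrightarrow> E \<in> energy_window lam"
  using closed_segment_energy_window by (auto simp: crossing_def)

lemma crossing_next_trace:
  assumes "crossing lam n a b"
  shows "trace_seq lam (Suc n) b \<le> - 2"
  using assms defect_nonpos[of b lam n] by (auto simp: crossing_def trace_seq_Suc)

lemma crossing_Suc:
  assumes cr: "crossing lam n a b"
  obtains c where "c \<in> closed_segment a b" "crossing lam (Suc n) a c"
proof -
  have a2: "trace_seq lam (Suc n) a = 2"
    using cr trace_seq_eq_2[of lam n a "Suc n"] by (auto simp: crossing_def)
  obtain c where c: "c \<in> closed_segment a b" "trace_seq lam (Suc n) c = 0"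
    "\<And>t. t \<in> closed_segment a c \<Longrightarrow> 0 \<le> trace_seq lam (Suc n) t"
    using first_zero_on_segment[of a b "trace_seq lam (Suc n)", OF continuous_on_trace_seq]
      crossing_next_trace[OF cr] a2 by auto
  show ?thesis
  proof (rule that[OF c(1)])
    show "crossing lam (Suc n) a c"
      using cr a2 c crossing_window[OF cr c(1)] by (simp add: crossing_def)
  qed
qed

lemma crossing_add:
  assumes cr: "crossing lam n a b"
  shows "\<exists>c\<in>closed_segment a b. crossing lam (n + k) a c \<and>
    (\<forall>i\<le>k. \<forall>E\<in>closed_segment a c. 0 \<le> trace_seq lam (n + i) E)"
proof (induction k)
  case 0
  then show ?case using cr by (intro bexI[of _ b]) (auto simp: crossing_def)
next
  case (Suc k)
  then obtain c where c: "c \<in> closed_segment a b" "crossing lam (n + k) a c"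
    "\<forall>i\<le>k. \<forall>E\<in>closed_segment a c. 0 \<le> trace_seq lam (n + i) E" by blast
  obtain d where d: "d \<in> closed_segment a c" "crossing lam (Suc (n + k)) a d"
    using crossing_Suc[OF c(2)] .
  have "closed_segment a d \<subseteq> closed_segment a c" using d(1) by (simp add: subset_closed_segment)
  moreover have "d \<in> closed_segment a b"
    using c(1) d(1) by (meson closed_segment_subset convex_closed_segment ends_in_segment(1) subsetD)
  moreover have "\<forall>E\<in>closed_segment a d. 0 \<le> trace_seq lam (Suc (n + k)) E"
    using d(2) by (simp add: crossing_def)
  ultimately show ?case
    using c(3) d(2) by (intro bexI[of _ d]) (auto simp: le_Suc_eq)
qed

lemma crossing_turn:
  assumes cr: "crossing lam n a b"
  shows "\<exists>c\<in>closed_segment a b. crossing lam (n + 2) b c \<and>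
    (\<forall>E\<in>closed_segment b c. trace_seq lam (n + 1) E \<le> 0)"
proof -
  obtain g where g: "g \<in> closed_segment a b" "crossing lam (Suc n) a g"
    using crossing_Suc[OF cr] .
  have b2: "trace_seq lam (Suc (Suc n)) b = 2"
    using cr by (intro trace_seq_zero_imp_2) (simp add: crossing_def)
  obtain c where c: "c \<in> closed_segment b g" "trace_seq lam (Suc (Suc n)) c = 0"
    "\<And>t. t \<in> closed_segment b c \<Longrightarrow> 0 \<le> trace_seq lam (Suc (Suc n)) t"
    using first_zero_on_segment[of b g "trace_seq lam (Suc (Suc n))", OF continuous_on_trace_seq]
      crossing_next_trace[OF g(2)] b2 by (auto)
  have cab: "c \<in> closed_segment a b"
    using c(1) g(1) by (meson closed_segment_subset convex_closed_segment ends_in_segment(2) subsetD)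
  have sub: "closed_segment b c \<subseteq> closed_segment a b" using cab by (simp add: subset_closed_segment)
  have "crossing lam (Suc (Suc n)) b c"
    using cr b2 c crossing_window[OF cr cab] by (simp add: crossing_def)
  moreover have "trace_seq lam (Suc n) E \<le> 0" if E: "E \<in> closed_segment b c" for E
  proof (rule ccontr)
    assume "\<not> trace_seq lam (Suc n) E \<le> 0"
    then obtain t where t: "t \<in> closed_segment b E" "- trace_seq lam (Suc n) t = 0"
      using first_zero_on_segment[of b E "\<lambda>t. - trace_seq lam (Suc n) t"]
        crossing_next_trace[OF cr] continuous_on_minus[OF continuous_on_trace_seq] by force
    then have tc: "t \<in> closed_segment b c" using E subset_closed_segment[of b E b c] by auto
    then have "t \<in> energy_window lam" using sub crossing_window[OF cr] by blast
    then show False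
      using c(3)[OF tc] t(2) trace_seq_Suc[of lam "Suc n" t] defect_nonpos[of t lam "Suc n"]
      by (simp)
  qed
  ultimately show ?thesis using cab by (intro bexI[of _ c]) (simp_all)
qed

definition small_crossing :: "real \<Rightarrow> nat \<Rightarrow> real \<Rightarrow> real \<Rightarrow> bool" where
  "small_crossing lam n a b \<longleftrightarrow>
     crossing lam n a b \<and> (\<forall>E\<in>closed_segment a b. \<bar>defect lam n E\<bar> \<le> 1)"

definition crossing_step :: "real \<Rightarrow> bool \<Rightarrow> nat \<Rightarrow> real \<times> real \<Rightarrow> real \<times> real \<Rightarrow> bool" where
  "crossing_step lam s n I J \<longleftrightarrow>
     closed_segment (fst J) (snd J) \<subseteq> closed_segment (fst I) (snd I) \<and>
     small_crossing lam (n + 6) (fst J) (snd J) \<and>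
     (\<forall>E\<in>closed_segment (fst J) (snd J).
        (\<forall>i\<le>6. \<bar>trace_seq lam (n + i) E\<bar> \<le> 3) \<and>
        (if s then 0 \<le> trace_seq lam (n + 5) E else trace_seq lam (n + 5) E \<le> - 1))"

lemma trace_bound_3:
  assumes "E \<in> energy_window lam" "\<bar>defect lam n E\<bar> \<le> 1"
  shows "\<bar>trace_seq lam (Suc n) E\<bar> \<le> 3"
proof -
  have "- 3 \<le> trace_seq lam (Suc n) E"
    using assms(2) zero_le_power2[of "trace_seq lam n E"] unfolding trace_seq_Suc abs_le_iff by linarith
  then show ?thesis using trace_seq_le_2[OF assms(1), of "Suc n"] by simp
qed

text \<open>
  The two branches keep the trace nonnegative for six steps, or for four steps followed by an
  excursion through \<open>-2\<close>.
\<close>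

lemma crossing_step_exists:
  assumes sm: "small_crossing lam n a b"
  shows "\<exists>J. crossing_step lam s n (a, b) J"
proof -
  have num: "Suc (n + 4) = n + 5" "Suc (n + 5) = n + 6" "n + 4 + 1 = n + 5" "n + 4 + 2 = n + 6"
    by simp_all
  have cr: "crossing lam n a b" and n1: "n \<ge> 1" using sm by (auto simp: small_crossing_def crossing_def)
  have four: "\<bar>defect lam (n + 4) E\<bar> \<le> 1 / 100"
    if "E \<in> closed_segment a b" "\<forall>i\<le>4. 0 \<le> trace_seq lam (n + i) E" for E
    using defect_contraction[of E lam n] crossing_window[OF cr that(1)] that sm
    by (force simp: small_crossing_def)
  have pos: "\<bar>trace_seq lam (n + i) E\<bar> \<le> 3"
    if "E \<in> closed_segment a b" "0 \<le> trace_seq lam (n + i) E" for E i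
    using trace_seq_le_2[OF crossing_window[OF cr that(1)], of "n + i"] n1 that(2) by simp
  show ?thesis
  proof (cases s)
    case True
    obtain c where c: "c \<in> closed_segment a b" "crossing lam (n + 6) a c"
      and nn: "\<And>i E. i \<le> 6 \<Longrightarrow> E \<in> closed_segment a c \<Longrightarrow> 0 \<le> trace_seq lam (n + i) E"
      using crossing_add[OF cr, of 6] by blast
    have sub: "closed_segment a c \<subseteq> closed_segment a b" using c(1) by (simp add: subset_closed_segment)
    have "\<bar>defect lam (n + 6) E\<bar> \<le> 1" if E: "E \<in> closed_segment a c" for E
    proof -
      have W: "E \<in> energy_window lam" using E sub crossing_window[OF cr] by blast
      have d4: "\<bar>defect lam (n + 4) E\<bar> \<le> 1 / 100" using four[of E] nn E sub by auto
      have e5: "\<bar>2 - trace_seq lam (n + 5) E\<bar> \<le> 2" "\<bar>2 - trace_seq lam (n + 6) E\<bar> \<le> 2"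
        using nn[OF _ E, of 5] nn[OF _ E, of 6] trace_seq_le_2[OF W, of "n + 5"]
          trace_seq_le_2[OF W, of "n + 6"] n1 by auto
      have "\<bar>defect lam (n + 6) E\<bar> =
          \<bar>2 - trace_seq lam (n + 6) E\<bar> * (\<bar>2 - trace_seq lam (n + 5) E\<bar> * \<bar>defect lam (n + 4) E\<bar>)"
        using defect_Suc[of lam "n + 5" E] defect_Suc[of lam "n + 4" E] unfolding num
        by (simp add: abs_mult)
      also have "\<dots> \<le> 2 * (2 * (1 / 100))" using e5 d4 by (intro mult_mono) auto
      finally show ?thesis by simp
    qed
    then have "crossing_step lam s n (a, b) (a, c)"
      using True sub c(2) nn pos by (auto simp: crossing_step_def small_crossing_def)
    then show ?thesis ..
  next
    case False
    obtain g where g: "g \<in> closed_segment a b" "crossing lam (n + 4) a g"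
      and nn: "\<And>i E. i \<le> 4 \<Longrightarrow> E \<in> closed_segment a g \<Longrightarrow> 0 \<le> trace_seq lam (n + i) E"
      using crossing_add[OF cr, of 4] by blast
    obtain c where c: "c \<in> closed_segment a g" "crossing lam (n + 6) g c"
      and neg: "\<And>E. E \<in> closed_segment g c \<Longrightarrow> trace_seq lam (n + 5) E \<le> 0"
      using crossing_turn[OF g(2)] unfolding num by blast
    have subg: "closed_segment g c \<subseteq> closed_segment a g" using c(1) by (simp add: subset_closed_segment)
    have "closed_segment a g \<subseteq> closed_segment a b" using g(1) by (simp add: subset_closed_segment)
    then have sub: "closed_segment g c \<subseteq> closed_segment a b" using subg by blast
    have facts: "\<bar>defect lam (n + 6) E\<bar> \<le> 1 \<and> \<bar>trace_seq lam (n + 5) E\<bar> \<le> 3 \<and>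
        0 \<le> trace_seq lam (n + 6) E \<and> trace_seq lam (n + 5) E \<le> - 1"
      if E: "E \<in> closed_segment g c" for E
    proof -
      have W: "E \<in> energy_window lam" using E sub crossing_window[OF cr] by blast
      have d4: "\<bar>defect lam (n + 4) E\<bar> \<le> 1 / 100" using four[of E] nn E sub subg by auto
      have x5: "\<bar>trace_seq lam (n + 5) E\<bar> \<le> 3"
        using trace_bound_3[OF W, of "n + 4"] d4 unfolding num by simp
      have x6: "0 \<le> trace_seq lam (n + 6) E" using c(2) E by (simp add: crossing_def)
      have e: "\<bar>2 - trace_seq lam (n + 5) E\<bar> \<le> 5" "\<bar>2 - trace_seq lam (n + 6) E\<bar> \<le> 2"
        using x5 x6 trace_seq_le_2[OF W, of "n + 6"] n1 by auto
      have "\<bar>defect lam (n + 6) E\<bar> =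
          \<bar>2 - trace_seq lam (n + 6) E\<bar> * (\<bar>2 - trace_seq lam (n + 5) E\<bar> * \<bar>defect lam (n + 4) E\<bar>)"
        using defect_Suc[of lam "n + 5" E] defect_Suc[of lam "n + 4" E] unfolding num
        by (simp add: abs_mult)
      also have "\<dots> \<le> 2 * (5 * (1 / 100))" using e d4 by (intro mult_mono) auto
      finally have d6: "\<bar>defect lam (n + 6) E\<bar> \<le> 1" by simp
      have "1\<^sup>2 \<le> (- trace_seq lam (n + 5) E)\<^sup>2"
        using trace_seq_Suc[of lam "n + 5" E] defect_nonpos[OF W, of "n + 5"] x6 unfolding num
        by simp
      then have "1 \<le> - trace_seq lam (n + 5) E" by (rule power2_le_imp_le) (use neg[OF E] in simp)
      then show ?thesis using d6 x5 x6 by simp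
    qed
    have "\<bar>trace_seq lam (n + i) E\<bar> \<le> 3" if "E \<in> closed_segment g c" "i \<le> 6" for E i
    proof -
      have E: "E \<in> closed_segment a b" "E \<in> closed_segment a g" using that(1) sub subg by auto
      consider "i \<le> 4" | "i = 5" | "i = 6" using \<open>i \<le> 6\<close> by linarith
      then show ?thesis
        by cases (use facts[OF that(1)] pos[OF E(1)] nn[OF _ E(2)] in auto)
    qed
    then have "crossing_step lam s n (a, b) (g, c)"
      using False sub c(2) facts by (auto simp: crossing_step_def small_crossing_def)
    then show ?thesis ..
  qed
qed

lemma initial_crossing: "\<exists>a b. crossing lam 2 a b"
proof -
  define a where "a = sqrt (lam\<^sup>2 + 2)"
  define e where "e = 1 + sqrt (lam\<^sup>2 + 1)"
  have "e\<^sup>2 = lam\<^sup>2 + 2 + 2 * sqrt (lam\<^sup>2 + 1)"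
    by (simp add: e_def power2_eq_square[of "1 + _"] algebra_simps)
  then have "lam\<^sup>2 + 2 \<le> e\<^sup>2" by simp
  then have "a \<le> e" unfolding a_def by (simp add: real_le_lsqrt e_def)
  have W: "closed_segment e a = energy_window lam"
    using \<open>a \<le> e\<close> by (simp add: closed_segment_eq_real_ivl energy_window_def a_def e_def)
  have x0: "trace_seq lam 0 a = 0" by (simp add: a_def)
  have x2: "trace_seq lam (Suc (Suc 0)) a = 2" using x0 by (rule trace_seq_zero_imp_2)
  have "trace_seq lam (Suc 0) a = - 2 - 4 * lam\<^sup>2" using x0 by simp
  then have x1: "trace_seq lam (Suc 0) a \<le> 0" using zero_le_power2[of lam] by linarith
  have "e\<^sup>2 - lam\<^sup>2 = 2 * e" by (simp add: e_def power2_eq_square[of "1 + _"] algebra_simps)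
  then have "trace_seq lam (Suc 0) e = (2 * e - 2)\<^sup>2 - 2 - 4 * lam\<^sup>2" by simp
  then have e2: "trace_seq lam (Suc 0) e = 2" by (simp add: e_def power_mult_distrib)
  obtain b where b: "b \<in> closed_segment e a" "trace_seq lam (Suc 0) b = 0"
    using first_zero_on_segment[of e a "trace_seq lam (Suc 0)", OF continuous_on_trace_seq] x1 e2 by force
  have bW: "b \<in> energy_window lam" using b W by simp
  have aW: "a \<in> energy_window lam" using W by auto
  have "trace_seq lam (Suc (Suc 0)) b \<le> 0"
    using b(2) defect_nonpos[OF bW, of "Suc 0"] by (simp only: trace_seq_Suc[of _ "Suc 0"]) simp
  then obtain c where c: "c \<in> closed_segment a b" "trace_seq lam (Suc (Suc 0)) c = 0"
    "\<And>t. t \<in> closed_segment a c \<Longrightarrow> 0 \<le> trace_seq lam (Suc (Suc 0)) t"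
    using first_zero_on_segment[of a b "trace_seq lam (Suc (Suc 0))", OF continuous_on_trace_seq] x2
    by (auto)
  have "c \<in> energy_window lam" using c(1) closed_segment_energy_window[OF aW bW] by blast
  then have "crossing lam (Suc (Suc 0)) a c"
    using x2 c aW by (simp add: crossing_def)
  then show ?thesis by (auto simp: numeral_2_eq_2)
qed

lemma small_crossing_exists: "\<exists>n a b. small_crossing lam n a b"
proof -
  obtain a b where cr: "crossing lam 2 a b" using initial_crossing by blast
  have "continuous_on (energy_window lam) (defect lam 2)"
    unfolding defect_def[abs_def] by (intro continuous_intros continuous_on_trace_seq)
  then obtain D where D: "\<And>E. E \<in> energy_window lam \<Longrightarrow> \<bar>defect lam 2 E\<bar> \<le> D"
    using compact_imp_bounded[OF compact_continuous_image[OF _ compact_energy_window], of lam "defect lam 2"]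
    unfolding bounded_iff by fastforce
  obtain k :: nat where k: "D < 100 ^ k" using real_arch_pow[of 100 D] by auto
  obtain c where c: "c \<in> closed_segment a b" "crossing lam (2 + 4 * k) a c"
    and nn: "\<And>i E. i \<le> 4 * k \<Longrightarrow> E \<in> closed_segment a c \<Longrightarrow> 0 \<le> trace_seq lam (2 + i) E"
    using crossing_add[OF cr, of "4 * k"] by blast
  have "\<bar>defect lam (2 + 4 * k) E\<bar> \<le> 1" if E: "E \<in> closed_segment a c" for E
  proof -
    have W: "E \<in> energy_window lam" using crossing_window[OF c(2) E] .
    have "\<bar>defect lam (2 + 4 * j) E\<bar> \<le> D / 100 ^ j" if "j \<le> k" for j
      using that
    proof (induction j)
      case 0
      then show ?case using D[OF W] by simp
    next
      case (Suc j)
      have "0 \<le> trace_seq lam (2 + 4 * j + i) E" if "i \<le> 4" for i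
        using nn[of "4 * j + i" E] E Suc.prems that by (simp add: add.assoc)
      then have "\<bar>defect lam (2 + 4 * j + 4) E\<bar> \<le> \<bar>defect lam (2 + 4 * j) E\<bar> / 100"
        by (rule defect_contraction[OF W])
      then show ?case using Suc by (simp add: algebra_simps)
    qed
    from this[of k] have "\<bar>defect lam (2 + 4 * k) E\<bar> \<le> D / 100 ^ k" by simp
    also have "\<dots> \<le> 1" using k by simp
    finally show ?thesis .
  qed
  then show ?thesis using c(2) by (auto simp: small_crossing_def)
qed

lemma trace_seq_lipschitz:
  "\<exists>L\<ge>0. \<forall>E\<in>energy_window lam. \<forall>E'\<in>energy_window lam.
     \<bar>trace_seq lam n E - trace_seq lam n E'\<bar> \<le> L * \<bar>E - E'\<bar>"
proof -
  let ?W = "energy_window lam"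
  have "\<exists>p. trace_seq lam n = poly p"
  proof (induction lam n "0::real" rule: trace_seq.induct)
    case (1 lam)
    show ?case by (rule exI[of _ "[:- lam\<^sup>2 - 2, 0, 1:]"]) (simp add: fun_eq_iff power2_eq_square algebra_simps)
  next
    case (2 lam)
    show ?case by (rule exI[of _ "[:- lam\<^sup>2 - 2, 0, 1:]\<^sup>2 - [:2 + 4 * lam\<^sup>2:]"])
        (simp add: fun_eq_iff power2_eq_square algebra_simps)
  next
    case (3 lam n)
    then obtain p q where "trace_seq lam n = poly p" "trace_seq lam (Suc n) = poly q" by blast
    then show ?case by (intro exI[of _ "p\<^sup>2 * (q - [:2:]) + [:2:]"]) (simp add: fun_eq_iff trace_seq.simps(3))
  qed
  then obtain p where p: "trace_seq lam n = poly p" by blast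
  have "bounded (poly (pderiv p) ` ?W)"
    by (intro compact_imp_bounded compact_continuous_image compact_energy_window continuous_intros)
  then obtain L where L: "\<And>x. x \<in> ?W \<Longrightarrow> \<bar>poly (pderiv p) x\<bar> \<le> L"
    by (auto simp: bounded_iff)
  have "\<bar>poly p E - poly p E'\<bar> \<le> \<bar>L\<bar> * \<bar>E - E'\<bar>" if "E \<in> ?W" "E' \<in> ?W" for E E'
    using field_differentiable_bound[of ?W "poly p" "poly (pderiv p)" "\<bar>L\<bar>" E E'] L that
    by (force simp: energy_window_def intro: poly_DERIV[THEN DERIV_subset])
  then show ?thesis using p by (intro exI[of _ "\<bar>L\<bar>"]) auto
qed

lemma trace_seq_growth:
  assumes "n \<ge> 1"
  obtains L where "L > 0" "\<And>E E' k. E \<in> energy_window lam \<Longrightarrow> E' \<in> energy_window lam \<Longrightarrow>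
      (\<And>m. n \<le> m \<Longrightarrow> m \<le> n + k \<Longrightarrow> \<bar>trace_seq lam m E\<bar> \<le> 3 \<and> \<bar>trace_seq lam m E'\<bar> \<le> 3) \<Longrightarrow>
      \<bar>trace_seq lam (n + k) E - trace_seq lam (n + k) E'\<bar> \<le> L * 12 ^ k * \<bar>E - E'\<bar>"
proof -
  obtain L0 where L0: "L0 \<ge> 0" "\<And>E E'. E \<in> energy_window lam \<Longrightarrow> E' \<in> energy_window lam \<Longrightarrow>
     \<bar>trace_seq lam n E - trace_seq lam n E'\<bar> \<le> L0 * \<bar>E - E'\<bar>" using trace_seq_lipschitz by blast
  obtain L1 where L1: "L1 \<ge> 0" "\<And>E E'. E \<in> energy_window lam \<Longrightarrow> E' \<in> energy_window lam \<Longrightarrow>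
     \<bar>trace_seq lam (Suc n) E - trace_seq lam (Suc n) E'\<bar> \<le> L1 * \<bar>E - E'\<bar>" using trace_seq_lipschitz by blast
  define L where "L = L0 + L1 + 1"
  have L: "L > 0" "L0 \<le> L" "L1 \<le> L * 12" using L0(1) L1(1) by (auto simp: L_def)
  show ?thesis
  proof (rule that[OF L(1)])
    fix E E' k
    assume E: "E \<in> energy_window lam" "E' \<in> energy_window lam"
    let ?x = "\<lambda>i. trace_seq lam (n + i) E" and ?y = "\<lambda>i. trace_seq lam (n + i) E'"
    let ?D = "\<lambda>i. \<bar>?x i - ?y i\<bar>"
    assume "\<And>m. n \<le> m \<Longrightarrow> m \<le> n + k \<Longrightarrow> \<bar>trace_seq lam m E\<bar> \<le> 3 \<and> \<bar>trace_seq lam m E'\<bar> \<le> 3"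
    then have bd: "\<bar>?x i\<bar> \<le> 3" "\<bar>?y i\<bar> \<le> 3" if "i \<le> k" for i using that by auto
    have "?D i \<le> L * 12 ^ i * \<bar>E - E'\<bar>" if "i \<le> k" for i
      using that
    proof (induction i rule: less_induct)
      case (less i)
      consider "i = 0" | "i = Suc 0" | j where "i = Suc (Suc j)" by (metis not0_implies_Suc)
      then show ?case
      proof cases
        case 1
        have "L0 * \<bar>E - E'\<bar> \<le> L * \<bar>E - E'\<bar>" using L by (intro mult_right_mono) auto
        then show ?thesis using 1 L0(2)[OF E] by simp
      next
        case 2
        have "L1 * \<bar>E - E'\<bar> \<le> L * 12 * \<bar>E - E'\<bar>" using L by (intro mult_right_mono) auto
        then show ?thesis using 2 L1(2)[OF E] by (simp)
      next
        case (3 j)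
        have D0: "?D j \<le> L * 12 ^ j * \<bar>E - E'\<bar>" and D1: "?D (Suc j) \<le> L * 12 ^ Suc j * \<bar>E - E'\<bar>"
          by (rule less.IH; use less.prems 3 in simp)+
        have "?x i - ?y i = (?x j + ?y j) * (?x (Suc j) - 2) * (?x j - ?y j)
            + (?y j)\<^sup>2 * (?x (Suc j) - ?y (Suc j))"
          unfolding 3 by (simp add: trace_seq.simps(3) power2_eq_square algebra_simps)
        then have "?D i \<le> \<bar>?x j + ?y j\<bar> * \<bar>?x (Suc j) - 2\<bar> * ?D j + (?y j)\<^sup>2 * ?D (Suc j)"
          by (metis abs_mult abs_power2 abs_triangle_ineq)
        also have "\<dots> \<le> 6 * 5 * ?D j + 3\<^sup>2 * ?D (Suc j)"
        proof (intro add_mono mult_mono)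
          show "(?y j)\<^sup>2 \<le> 3\<^sup>2" using bd(2)[of j] less.prems 3 by (intro power2_le_iff_abs_le[THEN iffD2]) auto
        qed (use bd[of j] bd[of "Suc j"] less.prems 3 in auto)
        also have "\<dots> \<le> 6 * 5 * (L * 12 ^ j * \<bar>E - E'\<bar>) + 3\<^sup>2 * (L * 12 ^ Suc j * \<bar>E - E'\<bar>)"
          using D0 D1 by (intro add_mono mult_left_mono) auto
        also have "\<dots> = 138 * (L * 12 ^ j * \<bar>E - E'\<bar>)" by simp
        also have "\<dots> \<le> 144 * (L * 12 ^ j * \<bar>E - E'\<bar>)"
          using L by (intro mult_right_mono mult_nonneg_nonneg) auto
        also have "\<dots> = L * 12 ^ i * \<bar>E - E'\<bar>" using 3 by simp
        finally show ?thesis .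
      qed
    qed
    then show "\<bar>trace_seq lam (n + k) E - trace_seq lam (n + k) E'\<bar> \<le> L * 12 ^ k * \<bar>E - E'\<bar>" by simp
  qed
qed


theorem theorem1p1:
  shows "\<exists>C::real. C > 0 \<and>
    (\<forall>lam::real. hausdorff_dim (spectrum (tm_hamiltonian lam)) \<ge> ennreal C)"
proof (intro exI[of _ "ln 2 / ln (12 ^ 6)"] conjI allI)
  show "0 < ln 2 / ln (12 ^ 6 :: real)" by simp
  fix lam :: real
  obtain n a b where init: "small_crossing lam n a b" using small_crossing_exists by blast
  have n1: "n \<ge> 1" using init by (simp add: small_crossing_def crossing_def)
  define nx where "nx s m I = (SOME J. crossing_step lam s m I J)" for s m I
  have nxt: "crossing_step lam s m I (nx s m I)" if "small_crossing lam m (fst I) (snd I)" for s m I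
    unfolding nx_def using crossing_step_exists[OF that, of s] by (auto intro: someI_ex)
  define seg where "seg w = rec_nat (a, b) (\<lambda>k. nx (w k) (n + 6 * k))" for w :: "nat \<Rightarrow> bool"
  have seg_simps: "seg w 0 = (a, b)" "seg w (Suc k) = nx (w k) (n + 6 * k) (seg w k)" for w k
    by (simp_all add: seg_def)
  define S where "S w k = closed_segment (fst (seg w k)) (snd (seg w k))" for w k
  have small: "small_crossing lam (n + 6 * k) (fst (seg w k)) (snd (seg w k))" for w k
  proof (induction k)
    case (Suc k)
    then show ?case using nxt[OF Suc, of "w k"] by (simp add: crossing_step_def seg_simps algebra_simps)
  qed (simp add: seg_simps init)
  have step: "crossing_step lam (w k) (n + 6 * k) (seg w k) (seg w (Suc k))" for w k
    using nxt[OF small] by (simp add: seg_simps)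
  have "S w (Suc k) \<subseteq> S w k" for w k using step[of w k] by (simp add: S_def crossing_step_def)
  then have anti: "S w l \<subseteq> S w k" if "k \<le> l" for w k l
    using that by (rule lift_Suc_antimono_le)
  let ?Z = "approx_point_spectrum (tm_hamiltonian lam)"
  have "\<exists>E. complex_of_real E \<in> ?Z \<and> (\<forall>k. E \<in> S w k)" for w
  proof -
    define z where "z k = snd (seg w k)" for k
    have zS: "z l \<in> S w k" if "k \<le> l" for k l using anti[OF that, of w] by (auto simp: S_def z_def)
    have zZ: "complex_of_real (z k) \<in> ?Z" for k
      using small[of k w] zero_trace_in_approx_point_spectrum[of lam "n + 6 * k" "z k"]
      by (simp add: small_crossing_def crossing_def z_def)
    have "compact (S w 0)" by (simp add: S_def)
    then obtain E r where r: "strict_mono r" and lim: "(z \<circ> r) \<longlonglongrightarrow> E"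
      using zS unfolding compact_def by blast
    have "E \<in> S w k" for k
    proof (rule Lim_in_closed_set[OF _ _ _ lim])
      show "closed (S w k)" by (simp add: S_def)
      show "\<forall>\<^sub>F l in sequentially. (z \<circ> r) l \<in> S w k"
      proof (rule eventually_sequentiallyI[of k])
        show "(z \<circ> r) l \<in> S w k" if "k \<le> l" for l
          using zS[OF order_trans[OF that seq_suble[OF r]]] by simp
      qed
    qed simp
    moreover have "complex_of_real E \<in> ?Z"
      using closed_approx_point_spectrum
      by (rule Lim_in_closed_set[OF _ _ _ tendsto_of_real[OF lim]]) (simp_all add: zZ)
    ultimately show ?thesis by blast
  qed
  then obtain p where pZ: "\<And>w. complex_of_real (p w) \<in> ?Z" and pS: "\<And>w k. p w \<in> S w k" by metis
  have pW: "p w \<in> energy_window lam" for w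
    using pS[of w 0] init crossing_window by (auto simp: S_def seg_simps small_crossing_def)
  have bd: "\<bar>trace_seq lam m (p w)\<bar> \<le> 3" if "n \<le> m" for w m
  proof -
    have "m = n + 6 * ((m - n) div 6) + (m - n) mod 6" using that by simp
    moreover have "(m - n) mod 6 \<le> 6" by (simp add: order_less_imp_le)
    ultimately show ?thesis
      using step[of w "(m - n) div 6"] pS[of w "Suc ((m - n) div 6)"]
      unfolding crossing_step_def S_def by metis
  qed
  obtain L where L: "L > 0" and growth: "\<And>E E' k. E \<in> energy_window lam \<Longrightarrow> E' \<in> energy_window lam \<Longrightarrow>
      (\<And>m. n \<le> m \<Longrightarrow> m \<le> n + k \<Longrightarrow> \<bar>trace_seq lam m E\<bar> \<le> 3 \<and> \<bar>trace_seq lam m E'\<bar> \<le> 3) \<Longrightarrow>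
      \<bar>trace_seq lam (n + k) E - trace_seq lam (n + k) E'\<bar> \<le> L * 12 ^ k * \<bar>E - E'\<bar>"
    using trace_seq_growth[OF n1] by blast
  show "ennreal (ln 2 / ln (12 ^ 6)) \<le> hausdorff_dim (spectrum (tm_hamiltonian lam))"
  proof (rule hausdorff_dim_ge_of_coding[where c = "1 / (L * 12 ^ 5)" and p = "\<lambda>w. complex_of_real (p w)"])
    show "complex_of_real (p w) \<in> spectrum (tm_hamiltonian lam)" for w
      using pZ approx_point_spectrum_subset by blast
    fix w w' :: "nat \<Rightarrow> bool" and k assume ne: "w k \<noteq> w' k"
    have sign: "if v k then 0 \<le> trace_seq lam (n + 6 * k + 5) (p v)
        else trace_seq lam (n + 6 * k + 5) (p v) \<le> - 1" for v
      using step[of v k] pS[of v "Suc k"] by (simp add: crossing_step_def S_def)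
    have "1 \<le> \<bar>trace_seq lam (n + (6 * k + 5)) (p w) - trace_seq lam (n + (6 * k + 5)) (p w')\<bar>"
      using sign[of w] sign[of w'] ne by (auto simp: add.assoc split: if_splits)
    also have "\<dots> \<le> L * 12 ^ (6 * k + 5) * \<bar>p w - p w'\<bar>"
      by (rule growth[OF pW pW]) (simp add: bd)
    finally have "1 \<le> L * 12 ^ 5 * (12 ^ 6) ^ k * \<bar>p w - p w'\<bar>"
      by (simp only: power_add power_mult mult.assoc mult.commute[of "12 ^ 5"])
    moreover have "dist (complex_of_real (p w)) (complex_of_real (p w')) = \<bar>p w - p w'\<bar>"
      by (simp add: dist_of_real dist_real_def)
    ultimately show "1 / (L * 12 ^ 5) / (12 ^ 6) ^ k
        \<le> dist (complex_of_real (p w)) (complex_of_real (p w'))"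
      using L by (simp add: field_simps)
  qed (use L in auto)
qed

end
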